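(* For each $b \in \{2,4\} \cup \{5,10,15,20,\ldots\}$, let $M_b$ be the largest finite distance that a four-digit base-$b$ number is from a (non-zero) fixed point of the Kaprekar function $K_b$; precisely, $M_b$ is the least integer $m \ge 0$ such that $K_b^m(x) = K_b^{m+1}(x)$ for all $x \in S_b$. Then: (i) $M_2 = 1$, $M_4 = 3$, $M_5 = 4$, $M_{10} = 7$, and $M_{20} = 10$. (ii) If $b = 5m \cdot 2^n$ for some odd integer $m > 1$ and some integer $n \ge 0$, then $M_b = n+2$. (iii) If $b = 5 \cdot 2^n$ and $n \ge 3$, then $$M_b = \begin{cases} 4n+6 & \text{if } n \equiv 0 \pmod 4,\\ 3n+5 & \text{if } n \equiv 1 \pmod 4,\\ 3n+5 & \text{if } n \equiv 2 \pmod 4,\\ 5n+6 & \text{if } n \equiv 3 \pmod 4. \end{cases}$$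
   Context: Let $b \ge 2$ be an integer. A four-digit base-$b$ number is an integer $x$ with $0 \le x < b^4$, written with exactly four base-$b$ digits (leading zeros allowed). The Kaprekar function $K_b$ maps such an $x$ to $K_b(x) = D - A$, where $D$ is the integer whose four base-$b$ digits are the digits of $x$ (with multiplicity, including leading zeros) arranged in descending order, and $A$ is the integer whose digits are the same digits arranged in ascending order. The result is again regarded as a four-digit base-$b$ number. $K_b^t$ denotes the $t$-fold iterate, with $K_b^0$ the identity. $S_b$ is the set of four-digit base-$b$ numbers $x$ for which the sequence $K_b^t(x)$ is eventually a non-zero constant as $t$ increases. *)

theory Defs
  imports Complex_Main
begin

text \<open>The four base-\<open>b\<close> digits of \<open>x < b ^ 4\<close>, leading zeros included, least significant digit first.\<close>

definition digits4 :: "nat \<Rightarrow> nat \<Rightarrow> nat list" where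
  "digits4 b x = map (\<lambda>i. x div b ^ i mod b) [0..<4]"

text \<open>
  The library function \<^const>\<open>horner_sum\<close> reads a list with the least significant digit first. Hence an
  increasingly sorted list gives the number whose digits, as written, are descending, and its
  reversal gives the one whose digits are ascending. The former is the larger of the two, so the
  subtraction of natural numbers in \<open>kaprekar\<close> does not truncate.
\<close>

definition descending_number :: "nat \<Rightarrow> nat \<Rightarrow> nat" where
  "descending_number b x = horner_sum id b (sort (digits4 b x))"

definition ascending_number :: "nat \<Rightarrow> nat \<Rightarrow> nat" where
  "ascending_number b x = horner_sum id b (rev (sort (digits4 b x)))"

definition kaprekar :: "nat \<Rightarrow> nat \<Rightarrow> nat" where
  "kaprekar b x = descending_number b x - ascending_number b x"

definition kaprekar_S :: "nat \<Rightarrow> nat set" where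
  "kaprekar_S b =
     {x. x < b ^ 4 \<and> (\<exists>c. c \<noteq> 0 \<and> (\<forall>\<^sub>F t in sequentially. (kaprekar b ^^ t) x = c))}"

definition kaprekar_M :: "nat \<Rightarrow> nat" where
  "kaprekar_M b =
     (LEAST m. \<forall>x\<in>kaprekar_S b. (kaprekar b ^^ m) x = (kaprekar b ^^ (m + 1)) x)"

text \<open>The minimum in \<open>kaprekar_M\<close> is over a nonempty set.\<close>

lemma kaprekar_M_exists:
  "\<exists>m. \<forall>x\<in>kaprekar_S b. (kaprekar b ^^ m) x = (kaprekar b ^^ (m + 1)) x"
proof -
  have "finite (kaprekar_S b)"
    by (rule finite_subset[of _ "{..<b ^ 4}"]) (auto simp: kaprekar_S_def)
  moreover have "\<forall>\<^sub>F t in sequentially. (kaprekar b ^^ t) x = (kaprekar b ^^ (t + 1)) x"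
    if "x \<in> kaprekar_S b" for x
  proof -
    from that obtain c where c: "\<forall>\<^sub>F t in sequentially. (kaprekar b ^^ t) x = c"
      by (auto simp: kaprekar_S_def)
    then obtain N where "\<And>t. t \<ge> N \<Longrightarrow> (kaprekar b ^^ t) x = c"
      unfolding eventually_sequentially by blast
    then show ?thesis
      unfolding eventually_sequentially by (metis le_add1 le_trans)
  qed
  ultimately have
    "\<forall>\<^sub>F t in sequentially. \<forall>x\<in>kaprekar_S b. (kaprekar b ^^ t) x = (kaprekar b ^^ (t + 1)) x"
    by (simp add: eventually_ball_finite)
  then show ?thesis
    unfolding eventually_sequentially by blast
qed

end

theory Submission
  imports Defs "HOL-Library.Multiset"
begin

text \<open>
  One step of the Kaprekar function depends only on the differences \<open>p\<close> and \<open>q\<close> of the two outer and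
  the two inner sorted digits. On the unordered pair \<open>{p, q}\<close> it acts as the tent map
  \<open>T x = \<bar>B - 2 * x\<bar>\<close> in both coordinates, except when a coordinate is zero or when
  \<open>T p = T q\<close>. For \<open>B = 5 * k\<close> the only nonzero fixed pair is \<open>{k, 3 * k}\<close>.

  If \<open>B = 5 * m * 2 ^ n\<close> with \<open>m > 1\<close> odd, the fixed pair consists of multiples of \<open>m\<close>, while after
  an exceptional step the coordinates are never both divisible by \<open>m\<close>. So convergence
  involves the tent map only, which needs \<open>n + 1\<close> steps to produce the factor \<open>2 ^ n\<close>.

  If \<open>B = 5 * 2 ^ n\<close>, a pair whose residues modulo 5 are \<open>\<plusminus>1\<close> and \<open>\<plusminus>2\<close> converges in \<open>n + 1\<close> steps, and
  every other pair meets an exceptional step. From then on the orbit passes through a few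
  explicit pairs, given by \<open>2 ^ n\<close>, \<open>2 * 2 ^ n\<close> and \<open>2 ^ j\<close> with \<open>j \<le> n\<close>, each at most \<open>n + 1\<close> steps
  after the previous one; which pair follows which depends on these powers modulo 5, hence on
  \<open>n mod 4\<close>.
\<close>

section \<open>Kaprekar steps on digit differences\<close>

definition tent :: "int \<Rightarrow> int \<Rightarrow> int" where
  "tent B x = \<bar>B - 2 * x\<bar>"

text \<open>
  If \<open>0 < q \<le> p\<close>, the digits of the difference \<open>p * (B ^ 3 - 1) + q * (B ^ 2 - B)\<close> are \<open>p\<close>, \<open>q - 1\<close>,
  \<open>B - 1 - q\<close>, \<open>B - p\<close>; if \<open>q = 0 < p\<close>, they are \<open>p - 1\<close>, \<open>B - 1\<close>, \<open>B - 1\<close>, \<open>B - p\<close>. States are pairs in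
  either order, so that no sorting is needed along an orbit.
\<close>

definition step :: "int \<Rightarrow> int \<times> int \<Rightarrow> int \<times> int" where
  "step B s = (case s of (x, y) \<Rightarrow>
     if x = 0 \<and> y = 0 then (0, 0)
     else if x = 0 then (y - 1, B - y)
     else if y = 0 then (x - 1, B - x)
     else if tent B x = tent B y then (tent B x + 1, \<bar>tent B x - 1\<bar>)
     else (tent B x, tent B y))"

definition valid :: "int \<Rightarrow> int \<times> int \<Rightarrow> bool" where
  "valid B s \<longleftrightarrow> fst s \<in> {0..<B} \<and> snd s \<in> {0..<B}"

text \<open>The descending minus the ascending number, in terms of the differences of the outer and
  of the inner sorted digits. \<open>max\<close> and \<open>min\<close> make it insensitive to the
  order of the pair.\<close>

definition weight :: "int \<Rightarrow> int \<times> int \<Rightarrow> int" where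
  "weight B s = max (fst s) (snd s) * (B ^ 3 - 1) + min (fst s) (snd s) * (B ^ 2 - B)"

definition spread :: "nat list \<Rightarrow> int \<times> int" where
  "spread l = (int (sort l ! 3) - int (sort l ! 0), int (sort l ! 2) - int (sort l ! 1))"

lemma weight_swap: "weight B (y, x) = weight B (x, y)"
  by (simp add: weight_def max.commute min.commute)

lemma weight_max_min: "weight B (max x y, min x y) = weight B (x, y)"
  by (cases "x \<le> y") (simp_all add: weight_def)

lemma valid_step: "valid B s \<Longrightarrow> valid B (step B s)"
  by (cases s) (auto simp: valid_def step_def tent_def)

lemma valid_funpow_step: "valid B s \<Longrightarrow> valid B ((step B ^^ t) s)"
  by (induction t) (auto intro: valid_step)

lemma length_4_cases:
  assumes "length l = 4"
  obtains a b c d where "l = [a, b, c, d]"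
  using assms by (auto simp: numeral_eq_Suc length_Suc_conv)

lemma digits4_eq: "digits4 b x = [x mod b, x div b mod b, x div b ^ 2 mod b, x div b ^ 3 mod b]"
proof -
  have "[0..<4] = [0, 1, 2, 3::nat]" by (simp add: upt_rec)
  then show ?thesis by (simp add: digits4_def)
qed

lemma digits4_horner:
  assumes "d0 < b" "d1 < b" "d2 < b" "d3 < (b::nat)"
  shows "digits4 b (d0 + b * (d1 + b * (d2 + b * d3))) = [d0, d1, d2, d3]"
proof -
  have 1: "(d + b * r) div b = r" "(d + b * r) mod b = d" if "d < b" for d r
    using that by auto
  have "b ^ 2 = b * b" "b ^ 3 = b * b * b" by (auto simp: power2_eq_square power3_eq_cube)
  then show ?thesis using assms by (simp add: digits4_eq div_mult2_eq 1)
qed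

lemma spread_bounds:
  assumes "b \<ge> 2" "length l = 4" "\<forall>d\<in>set l. d < b"
  shows "snd (spread l) \<le> fst (spread l)" "valid (int b) (spread l)"
proof -
  obtain p q r s where eq: "sort l = [p, q, r, s]"
    using length_4_cases[of "sort l"] assms(2) by (metis length_sort)
  have "sorted [p, q, r, s]" using sorted_sort[of l] eq by simp
  moreover have "s \<in> set (sort l)" by (simp add: eq)
  then have "s < b" using assms(3) by simp
  ultimately show "snd (spread l) \<le> fst (spread l)" "valid (int b) (spread l)"
    by (auto simp: spread_def eq valid_def)
qed

lemma kaprekar_eq_weight:
  assumes "b \<ge> 2"
  shows "int (kaprekar b x) = weight (int b) (spread (digits4 b x))"
proof -
  define l where "l = digits4 b x"
  have len: "length l = 4" by (simp add: l_def digits4_def)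
  have lt: "\<forall>d\<in>set l. d < b" using assms by (auto simp: l_def digits4_def)
  obtain p q r s where eq: "sort l = [p, q, r, s]"
    using length_4_cases[of "sort l"] len by (metis length_sort)
  have srt: "p \<le> q" "q \<le> r" "r \<le> s" using sorted_sort[of l] eq by auto
  have 1: "int (descending_number b x) = p + b * (q + b * (r + b * int s))"
    by (simp add: descending_number_def l_def[symmetric] eq)
  have 2: "int (ascending_number b x) = s + b * (r + b * (q + b * int p))"
    by (simp add: ascending_number_def l_def[symmetric] eq)
  have 3: "int (descending_number b x) - int (ascending_number b x)
      = (int s - p) * (int b ^ 3 - 1) + (int r - q) * (int b ^ 2 - b)"
    unfolding 1 2 by (simp add: power2_eq_square power3_eq_cube algebra_simps)
  have "int b ^ 2 - b \<ge> 0" "int b ^ 3 - 1 \<ge> 0" using assms by (auto simp: power2_eq_square)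
  then have "(int s - p) * (int b ^ 3 - 1) + (int r - q) * (int b ^ 2 - b) \<ge> 0"
    using srt by (intro add_nonneg_nonneg mult_nonneg_nonneg) auto
  then have "int (kaprekar b x) = (int s - p) * (int b ^ 3 - 1) + (int r - q) * (int b ^ 2 - b)"
    unfolding kaprekar_def 3[symmetric] by linarith
  also have "\<dots> = weight (int b) (spread l)"
    using srt by (simp add: weight_def spread_def eq max_absorb1 min_absorb2)
  finally show ?thesis by (simp add: l_def)
qed

lemma spread_eqI:
  assumes "mset l = {#a, b, c, d#}" "a \<le> b" "b \<le> c" "c \<le> d"
  shows "spread l = (int d - int a, int c - int b)"
proof -
  have "sort l = [a, b, c, d]"
    using assms by (intro properties_for_sort) auto
  then show ?thesis by (simp add: spread_def)
qed

text \<open>The digits \<open>p\<close> and \<open>b - p\<close> have sum \<open>b\<close> and gap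
  \<open>tent b p\<close>; the digits \<open>q - 1\<close> and \<open>b - 1 - q\<close> have sum
  \<open>b - 2\<close> and gap \<open>tent b q\<close>. The gaps have equal parity, so the pair with
  the larger gap encloses the other. With equal gaps the second pair is the first shifted down by 1,
  and the two interleave.\<close>

lemma spread_pairs:
  fixes b p q :: nat
  assumes "0 < q" "q \<le> p" "p < b"
  shows "spread [b - p, b - 1 - q, q - 1, p] =
    (if tent b p = tent b q then (tent b p + 1, \<bar>tent b p - 1\<bar>)
     else (max (tent b p) (tent b q), min (tent b p) (tent b q)))"
proof -
  define lo hi where "lo = min p (b - p)" and "hi = max p (b - p)"
  define lo' hi' where "lo' = min (q - 1) (b - 1 - q)" and "hi' = max (q - 1) (b - 1 - q)"
  have m: "mset [b - p, b - 1 - q, q - 1, p] = {#lo, hi, lo', hi'#}"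
    by (auto simp: lo_def hi_def lo'_def hi'_def max_def min_def)
  have s: "lo \<le> hi" "lo' \<le> hi'" "lo + hi = b" "lo' + hi' + 2 = b"
    using assms by (auto simp: lo_def hi_def lo'_def hi'_def max_def min_def)
  have "{int lo, int hi} = {int p, int b - int p}" "{int lo', int hi'} = {int q - 1, int b - 1 - int q}"
    using assms by (auto simp: lo_def hi_def lo'_def hi'_def max_def min_def)
  then have t: "tent b p = int hi - int lo" "tent b q = int hi' - int lo'"
    using s(1,2) by (auto simp: tent_def doubleton_eq_iff)
  consider "tent b p < tent b q" | "tent b q < tent b p"
    | "tent b p = tent b q" "lo \<le> hi'" | "tent b p = tent b q" "hi' < lo" by linarith
  then show ?thesis
  proof cases
    case 1
    then have "lo' \<le> lo" "hi \<le> hi'" using s t by linarith+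
    moreover have "mset [b - p, b - 1 - q, q - 1, p] = {#lo', lo, hi, hi'#}" using m by simp
    ultimately show ?thesis using 1 t spread_eqI[of _ lo' lo hi hi'] s by auto
  next
    case 2
    then have "lo \<le> lo'" "hi' \<le> hi" using s t by linarith+
    moreover have "mset [b - p, b - 1 - q, q - 1, p] = {#lo, lo', hi', hi#}" using m by simp
    ultimately show ?thesis using 2 t spread_eqI[of _ lo lo' hi' hi] s by auto
  next
    case 3
    then have "lo = lo' + 1" "hi = hi' + 1" using s t by linarith+
    moreover have "mset [b - p, b - 1 - q, q - 1, p] = {#lo', lo, hi', hi#}" using m by simp
    ultimately show ?thesis using 3 t spread_eqI[of _ lo' lo hi' hi] s by auto
  next
    \<comment> \<open>The common gap is 0 here, so \<open>tent b p - 1\<close> is negative and the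
      absolute value matters.\<close>
    case 4
    then have "lo = lo' + 1" "hi = hi' + 1" using s t by linarith+
    moreover have "mset [b - p, b - 1 - q, q - 1, p] = {#lo', hi', lo, hi#}" using m by simp
    ultimately show ?thesis using 4 t spread_eqI[of _ lo' hi' lo hi] s by auto
  qed
qed

text \<open>Borrowing in the subtraction gives the digits of the weight, with separate patterns when
  \<open>p\<close> or \<open>q\<close> vanishes. Only weights are compared because
  \<open>step\<close> may return the pair in the other order.\<close>

lemma weight_spread_digits4:
  assumes b: "b \<ge> 2" and s: "valid (int b) s" and x: "int x = weight (int b) s"
  shows "weight (int b) (spread (digits4 b x)) = weight (int b) (step (int b) s)"
proof -
  obtain p q where pq: "p = nat (max (fst s) (snd s))" "q = nat (min (fst s) (snd s))" by blast
  have le: "q \<le> p" "p < b" using s by (auto simp: pq valid_def)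
  have s': "s = (int p, int q) \<or> s = (int q, int p)"
    using s by (cases s) (auto simp: pq valid_def max_def min_def)
  have w: "weight (int b) s = int p * (int b ^ 3 - 1) + int q * (int b ^ 2 - int b)"
    using s' le by (auto simp: weight_def max_def min_def)
  consider "p = 0" | "p > 0" "q = 0" | "q > 0" by blast
  then show ?thesis
  proof cases
    case 1
    then have "x = 0 + b * (0 + b * (0 + b * 0))" using x w le by simp
    then have "digits4 b x = [0, 0, 0, 0]" using digits4_horner[of 0 b 0 0 0] b by simp
    moreover have "s = (0, 0)" using s' 1 le by auto
    ultimately show ?thesis by (simp add: spread_def weight_def step_def)
  next
    case 2
    have "int x = int ((b - p) + b * ((b - 1) + b * ((b - 1) + b * (p - 1))))"
      unfolding x w using 2 le b
      by (simp add: of_nat_diff power2_eq_square power3_eq_cube algebra_simps)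
    then have "x = (b - p) + b * ((b - 1) + b * ((b - 1) + b * (p - 1)))" by linarith
    then have "digits4 b x = [b - p, b - 1, b - 1, p - 1]"
      using digits4_horner[of "b - p" b "b - 1" "b - 1" "p - 1"] 2 le by simp
    moreover have "spread [b - p, b - 1, b - 1, p - 1] \<in> {(int p - 1, b - int p), (b - int p, int p - 1)}"
      using spread_eqI[of _ "b - p" "p - 1" "b - 1" "b - 1"]
        spread_eqI[of _ "p - 1" "b - p" "b - 1" "b - 1"] 2 le
      by (cases "b - p \<le> p - 1") (auto simp: of_nat_diff)
    ultimately show ?thesis using s' 2 le
      by (auto simp: step_def weight_swap)
  next
    case 3
    have "int (b - p) = int b - p" "int (b - 1 - q) = int b - 1 - q" "int (q - 1) = int q - 1"
      using 3 le by auto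
    then have "int x = int ((b - p) + b * ((b - 1 - q) + b * ((q - 1) + b * p)))"
      unfolding x w using 3 le b
      by (simp only: of_nat_add of_nat_mult) (simp add: power2_eq_square power3_eq_cube algebra_simps)
    then have "x = (b - p) + b * ((b - 1 - q) + b * ((q - 1) + b * p))" by linarith
    then have "digits4 b x = [b - p, b - 1 - q, q - 1, p]"
      using digits4_horner[of "b - p" b "b - 1 - q" "q - 1" "p"] 3 le by simp
    then have d: "spread (digits4 b x) = spread [b - p, b - 1 - q, q - 1, p]" by simp
    show ?thesis unfolding d spread_pairs[OF 3 le] using s' 3 le
      by (auto simp: step_def weight_swap weight_max_min)
  qed
qed

text \<open>Comparing weights instead of states allows a step that merely swaps the coordinates; a
  nonzero weight excludes the orbits that end in 0.\<close>

definition fixed :: "int \<Rightarrow> int \<times> int \<Rightarrow> bool" where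
  "fixed B s \<longleftrightarrow> weight B s \<noteq> 0 \<and> weight B (step B s) = weight B s"

lemma weight_nonneg:
  assumes "B \<ge> 2" "valid B s"
  shows "weight B s \<ge> 0"
proof -
  have "B ^ 2 \<ge> B" "B ^ 3 \<ge> 1"
    using assms(1) by (auto simp: power2_eq_square)
  then show ?thesis
    using assms(2) by (auto simp: weight_def valid_def)
qed

text \<open>The first application of \<open>kaprekar\<close> only forms the digit differences. Hence
  the shift by one between distances of states and \<open>kaprekar_M\<close>.\<close>

lemma funpow_kaprekar_eq_weight:
  assumes "b \<ge> 2"
  shows "int ((kaprekar b ^^ Suc t) x)
    = weight (int b) ((step (int b) ^^ t) (spread (digits4 b x)))"
proof (induction t)
  case 0
  then show ?case using kaprekar_eq_weight[OF assms] by simp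
next
  case (Suc t)
  have "\<forall>d\<in>set (digits4 b x). d < b" "length (digits4 b x) = 4"
    using assms by (auto simp: digits4_def)
  then have "valid (int b) ((step (int b) ^^ t) (spread (digits4 b x)))"
    using spread_bounds[OF assms] valid_funpow_step by simp
  from weight_spread_digits4[OF assms this Suc] show ?case
    using kaprekar_eq_weight[OF assms, of "(kaprekar b ^^ Suc t) x"] by simp
qed

lemma fixed_step:
  assumes "b \<ge> 2" "valid (int b) s" "fixed (int b) s"
  shows "fixed (int b) (step (int b) s)"
proof -
  define x where "x = nat (weight (int b) s)"
  have x: "int x = weight (int b) s"
    using weight_nonneg[of "int b" s] assms by (simp add: x_def)
  have x': "int x = weight (int b) (step (int b) s)"
    using x assms(3) by (simp add: fixed_def)
  have "weight (int b) (step (int b) s) = weight (int b) (step (int b) (step (int b) s))"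
    using weight_spread_digits4[OF assms(1,2) x]
      weight_spread_digits4[OF assms(1) valid_step[OF assms(2)] x'] by simp
  then show ?thesis
    using assms(3) by (simp add: fixed_def)
qed

lemma fixed_funpow_mono:
  assumes "b \<ge> 2" "valid (int b) s" "fixed (int b) ((step (int b) ^^ t) s)" "t \<le> u"
  shows "fixed (int b) ((step (int b) ^^ u) s)"
  using assms(4,3)
proof (induction u rule: dec_induct)
  case (step u)
  then show ?case
    using fixed_step[OF assms(1) valid_funpow_step[OF assms(2)]] by simp
qed

lemma funpow_eq_Suc_mono:
  fixes f :: "'a \<Rightarrow> 'a"
  assumes "(f ^^ t) x = (f ^^ Suc t) x" "t \<le> u"
  shows "(f ^^ u) x = (f ^^ t) x"
  using assms(2)
proof (induction u rule: dec_induct)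
  case (step u)
  then show ?case by (metis assms(1) comp_apply funpow.simps(2))
qed simp

text \<open>Two equal consecutive iterates already force constancy from there on.\<close>

lemma mem_kaprekar_S_iff:
  assumes b: "b \<ge> 2"
  shows "x \<in> kaprekar_S b \<longleftrightarrow>
    x < b ^ 4 \<and> (\<exists>t. fixed (int b) ((step (int b) ^^ t) (spread (digits4 b x))))"
proof -
  define w where "w t = weight (int b) ((step (int b) ^^ t) (spread (digits4 b x)))" for t
  have w: "int ((kaprekar b ^^ Suc t) x) = w t" for t
    using funpow_kaprekar_eq_weight[OF b] by (simp add: w_def)
  have fx: "fixed (int b) ((step (int b) ^^ t) (spread (digits4 b x)))
      \<longleftrightarrow> w t \<noteq> 0 \<and> w (Suc t) = w t" for t
    by (simp add: fixed_def w_def)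
  have "(\<exists>c. c \<noteq> 0 \<and> (\<forall>\<^sub>F t in sequentially. (kaprekar b ^^ t) x = c))
      \<longleftrightarrow> (\<exists>t. w t \<noteq> 0 \<and> w (Suc t) = w t)"
  proof
    assume "\<exists>c. c \<noteq> 0 \<and> (\<forall>\<^sub>F t in sequentially. (kaprekar b ^^ t) x = c)"
    then obtain c t where "c \<noteq> 0" "\<And>u. u \<ge> t \<Longrightarrow> (kaprekar b ^^ u) x = c"
      by (auto simp: eventually_sequentially)
    then have "w t = int c" "w (Suc t) = int c"
      unfolding w[symmetric] by (simp_all only: of_nat_eq_iff le_SucI order_refl lessI less_imp_le)
    then have "w t \<noteq> 0 \<and> w (Suc t) = w t"
      using \<open>c \<noteq> 0\<close> by simp
    then show "\<exists>t. w t \<noteq> 0 \<and> w (Suc t) = w t" ..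
  next
    assume "\<exists>t. w t \<noteq> 0 \<and> w (Suc t) = w t"
    then obtain t where t: "w t \<noteq> 0" "w (Suc t) = w t" by blast
    have "(kaprekar b ^^ Suc t) x = (kaprekar b ^^ Suc (Suc t)) x"
      using t(2) w by (metis of_nat_eq_iff)
    then have "(kaprekar b ^^ u) x = (kaprekar b ^^ Suc t) x" if "u \<ge> Suc t" for u
      using that by (rule funpow_eq_Suc_mono)
    moreover have "(kaprekar b ^^ Suc t) x \<noteq> 0"
      using t(1) w[of t] by simp
    ultimately show "\<exists>c. c \<noteq> 0 \<and> (\<forall>\<^sub>F t in sequentially. (kaprekar b ^^ t) x = c)"
      unfolding eventually_sequentially by blast
  qed
  then show ?thesis
    by (simp add: kaprekar_S_def fx)
qed

lemma ex_digits4_spread: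
  assumes "b \<ge> 2" "valid (int b) (p, q)" "q \<le> p"
  shows "\<exists>x < b ^ 4. spread (digits4 b x) = (p, q)"
proof -
  \<comment> \<open>The digits are \<open>p\<close>, \<open>q\<close>, 0, 0, so the outer difference
    is \<open>p\<close> and the inner one is \<open>q\<close>.\<close>
  define x where "x = nat p + b * (nat q + b * (0 + b * 0))"
  have lt: "nat p < b" "nat q < b" "nat q \<le> nat p" using assms by (auto simp: valid_def)
  have d: "digits4 b x = [nat p, nat q, 0, 0]"
    unfolding x_def using lt by (intro digits4_horner) auto
  have "x = nat p + b * nat q" by (simp add: x_def)
  also have "\<dots> < b + b * nat q" using lt by simp
  also have "\<dots> = b * (nat q + 1)" by simp
  also have "\<dots> \<le> b * b" using lt by (intro mult_left_mono) auto
  also have "\<dots> = b ^ 2" by (simp add: power2_eq_square)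
  also have "\<dots> \<le> b ^ 4" using assms by (intro power_increasing) auto
  finally have "x < b ^ 4" .
  moreover have "spread [nat p, nat q, 0, 0] = (p, q)"
    using lt assms(2,3) by (auto simp: spread_def valid_def)
  ultimately show ?thesis using d by metis
qed

lemma kaprekar_M_le:
  assumes b: "b \<ge> 2"
    and upper: "\<And>s t. valid (int b) s \<Longrightarrow> fixed (int b) ((step (int b) ^^ t) s)
      \<Longrightarrow> fixed (int b) ((step (int b) ^^ N) s)"
  shows "\<forall>x\<in>kaprekar_S b. (kaprekar b ^^ Suc N) x = (kaprekar b ^^ Suc (Suc N)) x"
proof
  fix x assume "x \<in> kaprekar_S b"
  then obtain t where t: "fixed (int b) ((step (int b) ^^ t) (spread (digits4 b x)))"
    using mem_kaprekar_S_iff[OF b] by blast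
  have "\<forall>d\<in>set (digits4 b x). d < b" "length (digits4 b x) = 4"
    using b by (auto simp: digits4_def)
  then have "fixed (int b) ((step (int b) ^^ N) (spread (digits4 b x)))"
    using upper[OF _ t] spread_bounds[OF b] by simp
  then have "int ((kaprekar b ^^ Suc N) x) = int ((kaprekar b ^^ Suc (Suc N)) x)"
    unfolding funpow_kaprekar_eq_weight[OF b] by (simp add: fixed_def)
  then show "(kaprekar b ^^ Suc N) x = (kaprekar b ^^ Suc (Suc N)) x" by (simp only: of_nat_eq_iff)
qed

text \<open>The state \<open>(p, q)\<close> becomes fixed after exactly \<open>Suc N\<close> steps,
  and forming the differences costs one more application.\<close>

lemma kaprekar_M_eqI:
  assumes b: "b \<ge> 2"
    and upper: "\<And>s t. valid (int b) s \<Longrightarrow> fixed (int b) ((step (int b) ^^ t) s)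
      \<Longrightarrow> fixed (int b) ((step (int b) ^^ Suc N) s)"
    and s: "valid (int b) (p, q)" "q \<le> p"
    and lower: "fixed (int b) ((step (int b) ^^ Suc N) (p, q))"
      "\<not> fixed (int b) ((step (int b) ^^ N) (p, q))"
  shows "kaprekar_M b = N + 2"
  unfolding kaprekar_M_def
proof (rule Least_equality)
  show "\<forall>x\<in>kaprekar_S b. (kaprekar b ^^ (N + 2)) x = (kaprekar b ^^ (N + 2 + 1)) x"
    using kaprekar_M_le[OF b upper] by simp
next
  fix m
  assume m: "\<forall>x\<in>kaprekar_S b. (kaprekar b ^^ m) x = (kaprekar b ^^ (m + 1)) x"
  obtain x where x: "x < b ^ 4" "spread (digits4 b x) = (p, q)"
    using ex_digits4_spread[OF b s] by blast
  then have S: "x \<in> kaprekar_S b"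
    using lower(1) mem_kaprekar_S_iff[OF b] by metis
  show "N + 2 \<le> m"
  proof (rule ccontr)
    assume "\<not> N + 2 \<le> m"
    then have le: "m \<le> Suc N" by simp
    have "(kaprekar b ^^ m) x = (kaprekar b ^^ Suc m) x" using m S by simp
    note eq = funpow_eq_Suc_mono[OF this]
    have "(kaprekar b ^^ Suc (Suc N)) x = (kaprekar b ^^ Suc N) x"
      using eq[of "Suc (Suc N)"] eq[of "Suc N"] le by simp
    \<comment> \<open>Equal weights at \<open>N\<close> and \<open>Suc N\<close> would make the
      state fixed already at \<open>N\<close>.\<close>
    then have "weight (int b) ((step (int b) ^^ Suc N) (p, q)) = weight (int b) ((step (int b) ^^ N) (p, q))"
      using funpow_kaprekar_eq_weight[OF b, of _ x] x(2) by metis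
    then show False
      using lower by (auto simp: fixed_def)
  qed
qed

text \<open>Induction on \<open>t\<close>: the claim for the successor of \<open>s\<close> makes
  \<open>s\<close> fixed after \<open>Suc N\<close> steps, and the assumption removes one of
  them.\<close>

lemma fixed_funpow_bounded:
  assumes "b \<ge> 2"
    and N: "\<And>s. valid (int b) s \<Longrightarrow> fixed (int b) ((step (int b) ^^ Suc N) s)
      \<Longrightarrow> fixed (int b) ((step (int b) ^^ N) s)"
  shows "valid (int b) s \<Longrightarrow> fixed (int b) ((step (int b) ^^ t) s)
    \<Longrightarrow> fixed (int b) ((step (int b) ^^ N) s)"
proof (induction t arbitrary: s)
  case 0
  then show ?case using fixed_funpow_mono[OF assms(1), of s 0] by simp
next
  case (Suc t)
  have "fixed (int b) ((step (int b) ^^ t) (step (int b) s))"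
    using Suc.prems(2) by (simp add: funpow_swap1)
  then have "fixed (int b) ((step (int b) ^^ Suc N) s)"
    using Suc.IH[OF valid_step] Suc.prems(1) by (simp add: funpow_swap1)
  then show ?case using N Suc.prems(1) by blast
qed

section \<open>Small bases\<close>

text \<open>If no state at distance \<open>N + 1\<close> from the fixed states exists, then no state has a larger finite
  distance; this reduces a concrete base to a finite check.\<close>

definition no_later_fixed :: "nat \<Rightarrow> int \<Rightarrow> bool" where
  "no_later_fixed N B \<longleftrightarrow> list_all (\<lambda>s. let s' = (step B ^^ N) s in
     fixed B (step B s') \<longrightarrow> fixed B s') (List.product [0..B - 1] [0..B - 1])"

lemma fixed_funpow_if_no_later_fixed:
  assumes b: "b \<ge> 2" and N: "no_later_fixed N (int b)"
    and s: "valid (int b) s" "fixed (int b) ((step (int b) ^^ t) s)"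
  shows "fixed (int b) ((step (int b) ^^ N) s)"
proof (rule fixed_funpow_bounded[OF b _ s])
  fix s assume "valid (int b) s"
  then have "s \<in> set (List.product [0..int b - 1] [0..int b - 1])"
    by (cases s) (auto simp: valid_def)
  moreover assume "fixed (int b) ((step (int b) ^^ Suc N) s)"
  ultimately show "fixed (int b) ((step (int b) ^^ N) s)"
    using N by (auto simp: no_later_fixed_def list_all_iff Let_def)
qed

text \<open>Proved directly, since \<open>kaprekar_M_eqI\<close> only yields values of at least 2.
  The witness 8 is 1000 in binary; it goes to 7, which is fixed.\<close>

lemma kaprekar_M_2: "kaprekar_M 2 = 1"
  unfolding kaprekar_M_def
proof (rule Least_equality)
  have "no_later_fixed 0 2" by code_simp
  then show "\<forall>x\<in>kaprekar_S 2. (kaprekar 2 ^^ 1) x = (kaprekar 2 ^^ (1 + 1)) x"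
    using kaprekar_M_le[of 2 0] fixed_funpow_if_no_later_fixed[of 2 0] by simp
next
  fix m
  assume m: "\<forall>x\<in>kaprekar_S 2. (kaprekar 2 ^^ m) x = (kaprekar 2 ^^ (m + 1)) x"
  have "fixed (int 2) ((step (int 2) ^^ 0) (spread (digits4 2 8)))" by code_simp
  then have "8 \<in> kaprekar_S 2"
    using mem_kaprekar_S_iff[of 2 8] by fastforce
  moreover have "kaprekar 2 8 \<noteq> 8" by code_simp
  ultimately show "1 \<le> m" using m by (cases m) auto
qed

text \<open>The upper bound is an exhaustive check. The lower bound is the orbit
  \<open>(2, 2)\<close>, \<open>(1, 1)\<close>, \<open>(3, 1)\<close>, whose last state is
  fixed.\<close>

lemma kaprekar_M_4: "kaprekar_M 4 = 3"
proof -
  have "no_later_fixed 2 4" by code_simp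
  moreover have "fixed 4 ((step 4 ^^ 2) (2, 2)) \<and> \<not> fixed 4 ((step 4 ^^ 1) (2, 2))"
    by code_simp
  ultimately show ?thesis
    using kaprekar_M_eqI[of 4 1 2 2] fixed_funpow_if_no_later_fixed[of 4 2]
    by (simp add: valid_def eval_nat_numeral)
qed

lemma kaprekar_M_5: "kaprekar_M 5 = 4"
proof -
  have "no_later_fixed 3 5" by code_simp
  moreover have "fixed 5 ((step 5 ^^ 3) (3, 0)) \<and> \<not> fixed 5 ((step 5 ^^ 2) (3, 0))"
    by code_simp
  ultimately show ?thesis
    using kaprekar_M_eqI[of 5 2 3 0] fixed_funpow_if_no_later_fixed[of 5 3]
    by (simp add: valid_def eval_nat_numeral)
qed

lemma kaprekar_M_10: "kaprekar_M 10 = 7"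
proof -
  have "no_later_fixed 6 10" by code_simp
  moreover have "fixed 10 ((step 10 ^^ 6) (4, 1)) \<and> \<not> fixed 10 ((step 10 ^^ 5) (4, 1))"
    by code_simp
  ultimately show ?thesis
    using kaprekar_M_eqI[of 10 5 4 1] fixed_funpow_if_no_later_fixed[of 10 6]
    by (simp add: valid_def eval_nat_numeral)
qed

lemma kaprekar_M_20: "kaprekar_M 20 = 10"
proof -
  have "no_later_fixed 9 20" by code_simp
  moreover have "fixed 20 ((step 20 ^^ 9) (5, 1)) \<and> \<not> fixed 20 ((step 20 ^^ 8) (5, 1))"
    by code_simp
  ultimately show ?thesis
    using kaprekar_M_eqI[of 20 8 5 1] fixed_funpow_if_no_later_fixed[of 20 9]
    by (simp add: valid_def eval_nat_numeral)
qed

section \<open>Bases divisible by 5\<close>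

text \<open>With \<open>B = 5 * k\<close> the tent map exchanges \<open>k\<close> and
  \<open>3 * k\<close>. For \<open>B = 10\<close> the weight of this pair is Kaprekar's constant
  6174.\<close>

definition fixed_pair :: "int \<Rightarrow> (int \<times> int) set" where
  "fixed_pair B = {(B div 5, 3 * (B div 5)), (3 * (B div 5), B div 5)}"

definition reaches :: "int \<Rightarrow> nat \<Rightarrow> int \<times> int \<Rightarrow> bool" where
  "reaches B t s \<longleftrightarrow> (step B ^^ t) s \<in> fixed_pair B"

text \<open>This holds vacuously for states that never reach the fixed pair.\<close>

definition reaches_by :: "int \<Rightarrow> nat \<Rightarrow> int \<times> int \<Rightarrow> bool" where
  "reaches_by B t s \<longleftrightarrow> (\<forall>u. reaches B u s \<longrightarrow> reaches B t s)"

text \<open>An orbit segment of length \<open>j\<close>, observed only through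
  \<open>reaches\<close>. This makes the relation insensitive to swapping coordinates, as
  \<open>leads_swap\<close> shows.\<close>

definition leads :: "int \<Rightarrow> nat \<Rightarrow> int \<times> int \<Rightarrow> int \<times> int \<Rightarrow> bool" where
  "leads B j s s' \<longleftrightarrow> (\<forall>t. reaches B (j + t) s \<longleftrightarrow> reaches B t s')"

text \<open>The nonzero squares and the nonsquares modulo 5. Both classes are closed under sign,
  which absorbs the absolute value in \<open>tent\<close>, and doubling exchanges them.\<close>

definition res1 :: "int \<Rightarrow> bool" where "res1 x \<longleftrightarrow> x mod 5 = 1 \<or> x mod 5 = 4"
definition res2 :: "int \<Rightarrow> bool" where "res2 x \<longleftrightarrow> x mod 5 = 2 \<or> x mod 5 = 3"

lemma reaches_0: "reaches B 0 s \<longleftrightarrow> s \<in> fixed_pair B"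
  by (simp add: reaches_def)

lemma reaches_Suc: "reaches B (Suc t) s \<longleftrightarrow> reaches B t (step B s)"
  by (simp add: reaches_def funpow_swap1)

lemma tent_eq_iff: "tent B x = tent B y \<longleftrightarrow> x = y \<or> x + y = B"
  by (auto simp: tent_def abs_if)

lemma tent_reflect: "tent B (B - x) = tent B x"
  by (simp add: tent_def)

lemma tent_bounds: "0 < x \<Longrightarrow> x < B \<Longrightarrow> 0 \<le> tent B x \<and> tent B x < B"
  by (auto simp: tent_def)

lemma step_tent:
  "x \<noteq> 0 \<Longrightarrow> y \<noteq> 0 \<Longrightarrow> tent B x \<noteq> tent B y \<Longrightarrow> step B (x, y) = (tent B x, tent B y)"
  by (simp add: step_def)

lemma step_swap: "step B (y, x) \<in> {step B (x, y), prod.swap (step B (x, y))}"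
  by (auto simp: step_def)

lemma fixed_pair_swap: "(y, x) \<in> fixed_pair B \<longleftrightarrow> (x, y) \<in> fixed_pair B"
  by (auto simp: fixed_pair_def)

lemma reaches_swap: "reaches B t (y, x) \<longleftrightarrow> reaches B t (x, y)"
proof (induction t arbitrary: x y)
  case 0
  show ?case by (simp add: reaches_0 fixed_pair_swap)
next
  case (Suc t)
  have "reaches B t (prod.swap (step B (x, y))) \<longleftrightarrow> reaches B t (step B (x, y))"
    using Suc by (cases "step B (x, y)") simp
  then show ?case using step_swap[of B y x] by (auto simp: reaches_Suc)
qed

lemma step_fixed_pair:
  assumes "5 dvd B" "B > 0" "s \<in> fixed_pair B"
  shows "step B s \<in> fixed_pair B"
  using assms by (auto simp: fixed_pair_def step_def tent_def)

lemma reaches_mono: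
  assumes "5 dvd B" "B > 0" "reaches B t s" "t \<le> u"
  shows "reaches B u s"
  using assms(4,3)
proof (induction u rule: dec_induct)
  case (step u)
  then show ?case using step_fixed_pair[OF assms(1,2)] by (simp add: reaches_def)
qed

lemma leads_refl: "leads B 0 s s" by (simp add: leads_def)

lemma leads_swap: "leads B j s (y, x) \<longleftrightarrow> leads B j s (x, y)" "leads B j (y, x) s \<longleftrightarrow> leads B j (x, y) s"
  by (simp_all add: leads_def reaches_swap[of _ _ y x])

lemma leads_trans: "leads B i s s' \<Longrightarrow> leads B j s' s'' \<Longrightarrow> leads B (i + j) s s''"
  by (simp add: leads_def add.assoc)

lemma leads_step: "leads B 1 s (step B s)"
  by (simp add: leads_def reaches_Suc)

lemma leads_tent:
  "x \<noteq> 0 \<Longrightarrow> y \<noteq> 0 \<Longrightarrow> tent B x \<noteq> tent B y \<Longrightarrow> leads B 1 (x, y) (tent B x, tent B y)"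
  using leads_step[of B "(x, y)"] by (simp add: step_tent)

lemma leads_coincidence:
  "x \<noteq> 0 \<Longrightarrow> y \<noteq> 0 \<Longrightarrow> tent B x = u \<Longrightarrow> tent B y = u \<Longrightarrow> leads B 1 (x, y) (u + 1, \<bar>u - 1\<bar>)"
  using leads_step[of B "(x, y)"] by (simp add: step_def)

lemma leads_zero: "x \<noteq> 0 \<Longrightarrow> leads B 1 (0, x) (x - 1, B - x)"
  using leads_step[of B "(0, x)"] by (simp add: step_def)

lemma leads_tent_funpow:
  assumes "\<And>j. j < k \<Longrightarrow> (tent B ^^ j) x \<noteq> 0 \<and> (tent B ^^ j) y \<noteq> 0"
    and "\<And>j. 0 < j \<Longrightarrow> j \<le> k \<Longrightarrow> (tent B ^^ j) x \<noteq> (tent B ^^ j) y"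
  shows "leads B k (x, y) ((tent B ^^ k) x, (tent B ^^ k) y)"
  using assms
proof (induction k)
  case 0
  show ?case by (simp add: leads_refl)
next
  case (Suc k)
  have "leads B 1 ((tent B ^^ k) x, (tent B ^^ k) y) ((tent B ^^ Suc k) x, (tent B ^^ Suc k) y)"
    using Suc.prems(1)[of k] Suc.prems(2)[of "Suc k"] leads_tent by simp
  from leads_trans[OF Suc.IH this] Suc.prems show ?case by simp
qed

lemma reaches_by_mono:
  "5 dvd B \<Longrightarrow> B > 0 \<Longrightarrow> reaches_by B t s \<Longrightarrow> t \<le> u \<Longrightarrow> reaches_by B u s"
  using reaches_mono unfolding reaches_by_def by blast

lemma reaches_by_swap: "reaches_by B t (y, x) \<longleftrightarrow> reaches_by B t (x, y)"
  by (simp add: reaches_by_def reaches_swap[of _ _ y x])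

lemma reaches_by_leads:
  assumes B: "5 dvd B" "B > 0" and "leads B j s s'" "reaches_by B t s'" "j + t \<le> T"
  shows "reaches_by B T s"
  unfolding reaches_by_def
proof (intro allI impI)
  fix u assume "reaches B u s"
  then have "reaches B (j + u) s" using reaches_mono[OF B] by simp
  then have "reaches B (j + t) s"
    using assms(3,4) by (auto simp: leads_def reaches_by_def)
  then show "reaches B T s" using reaches_mono[OF B] assms(5) by blast
qed

lemma reaches_imp_reaches_by: "reaches B t s \<Longrightarrow> reaches_by B t s"
  by (simp add: reaches_by_def)

text \<open>The fixed pair is never reached: reaching it after \<open>u > j\<close> steps would mean
  reaching it after \<open>u - Suc j\<close> steps, and reaching it earlier would, by monotonicity
  and the loop, put \<open>s\<close> itself into the pair.\<close>

lemma reaches_by_loop: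
  assumes B: "5 dvd B" "B > 0" and loop: "leads B (Suc j) s s" and s: "s \<notin> fixed_pair B"
  shows "reaches_by B t s"
proof -
  have "\<not> reaches B u s" for u
  proof (induction u rule: less_induct)
    case (less u)
    show ?case
    proof (cases "u \<le> j")
      case True
      have "\<not> reaches B (Suc j + 0) s"
        using loop s unfolding leads_def reaches_0[symmetric] by blast
      then show ?thesis using reaches_mono[OF B, of u s "Suc j"] True by auto
    next
      case False
      then have "u = Suc j + (u - Suc j)" by simp
      then show ?thesis using less[of "u - Suc j"] loop False unfolding leads_def
        by (metis diff_less not_le zero_less_Suc less_le_trans Suc_leI le_imp_less_Suc not_less_eq_eq)
    qed
  qed
  then show ?thesis by (simp add: reaches_by_def)
qed

text \<open>The coefficient \<open>B ^ 3 - 1\<close> of the maximum exceeds anything the minimum can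
  contribute, so the weight determines the maximum and then the minimum.\<close>

lemma weight_eq_iff:
  assumes B: "B \<ge> 2" and v: "valid B (x, y)" "valid B (x', y')"
  shows "weight B (x, y) = weight B (x', y') \<longleftrightarrow> (x', y') = (x, y) \<or> (x', y') = (y, x)"
proof
  define p q p' q' where "p = max x y" and "q = min x y" and "p' = max x' y'" and "q' = min x' y'"
  note defs = p_def q_def p'_def q'_def
  have b: "0 \<le> q" "q < B" "0 \<le> q'" "q' < B" using v by (auto simp: defs valid_def)
  assume "weight B (x, y) = weight B (x', y')"
  then have eq: "(p - p') * (B ^ 3 - 1) = (q' - q) * (B ^ 2 - B)"
    by (simp add: weight_def defs algebra_simps)
  have pos: "B ^ 2 - B > 0" "B ^ 3 - 1 > 0"
    using B by (auto simp: power2_eq_square intro: power_gt1)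
  have "\<bar>p - p'\<bar> * (B ^ 3 - 1) = \<bar>q' - q\<bar> * (B ^ 2 - B)"
    using arg_cong[OF eq, of abs] pos by (simp add: abs_mult)
  also have "\<dots> \<le> (B - 1) * (B ^ 2 - B)" using b pos by (intro mult_right_mono) auto
  also have "\<dots> < 1 * (B ^ 3 - 1)"
  proof -
    have "(B ^ 3 - 1) - (B - 1) * (B ^ 2 - B) = (B - 1) * (2 * B + 1)"
      by (simp add: power2_eq_square power3_eq_cube algebra_simps)
    moreover have "(B - 1) * (2 * B + 1) > 0" using B by simp
    ultimately show ?thesis by simp
  qed
  finally have "\<bar>p - p'\<bar> < 1" using pos by (simp only: mult_less_cancel_right)
  then have "p = p'" by simp
  with eq pos have "q = q'" by simp
  with \<open>p = p'\<close> show "(x', y') = (x, y) \<or> (x', y') = (y, x)"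
    by (auto simp: defs max_def min_def split: if_splits)
next
  assume "(x', y') = (x, y) \<or> (x', y') = (y, x)"
  then show "weight B (x, y) = weight B (x', y')" by (auto simp: weight_swap)
qed

text \<open>Away from exceptional steps, both coordinates fixed by the tent map would be
  \<open>B / 3\<close> and so equal; exchanged coordinates must be \<open>k\<close> and
  \<open>3 * k\<close>. Exceptional steps repeat a pair only for bases too small to be divisible by
  5.\<close>

lemma fixed_iff_fixed_pair:
  assumes B: "5 dvd B" "B > 0" and s: "valid B s"
  shows "fixed B s \<longleftrightarrow> s \<in> fixed_pair B"
proof -
  obtain k where k: "B = 5 * k" "k \<ge> 1" using B by (auto elim!: dvdE)
  then have B5: "B \<ge> 5" "B div 5 \<ge> 1" by auto
  obtain x y where xy: "s = (x, y)" by fastforce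
  obtain x' y' where xy': "step B s = (x', y')" by fastforce
  have w0: "weight B (0, 0) = 0" by (simp add: weight_def)
  have "fixed B s \<longleftrightarrow> (x, y) \<noteq> (0, 0) \<and> ((x', y') = (x, y) \<or> (x', y') = (y, x))"
    using weight_eq_iff[of B x y 0 0] weight_eq_iff[of B x' y' x y] s valid_step[OF s] k
    unfolding fixed_def xy' unfolding xy w0 by (auto simp: valid_def xy xy')
  also have "\<dots> \<longleftrightarrow> s \<in> fixed_pair B"
  proof (cases "x = 0 \<or> y = 0")
    case True
    then show ?thesis using xy' B5 s
      by (auto simp: xy fixed_pair_def step_def valid_def split: if_splits)
  next
    case False
    then have pos: "0 < x" "x < B" "0 < y" "y < B" using s by (auto simp: xy valid_def)
    have fp: "s \<in> fixed_pair B \<longleftrightarrow> x = k \<and> y = 3 * k \<or> x = 3 * k \<and> y = k"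
      by (simp add: xy fixed_pair_def k(1))
    show ?thesis
    proof (cases "tent B x = tent B y")
      case True
      define u where "u = tent B x"
      have "x = y \<or> x + y = B" using True by (simp add: tent_eq_iff)
      moreover have "u = B - 2 * x \<or> u = 2 * x - B" "u = B - 2 * y \<or> u = 2 * y - B" "u \<ge> 0"
        using True unfolding u_def tent_def by linarith+
      moreover have "x' = u + 1" "y' = u - 1 \<or> y' = 1 - u"
        using xy' False True by (auto simp: xy step_def u_def)
      \<comment> \<open>A coincidence can reproduce its own pair only for \<open>B = 2\<close> or
        \<open>B = 4\<close>.\<close>
      ultimately have "\<not> (x' = x \<and> y' = y \<or> x' = y \<and> y' = x)"
        using pos B5(1) by (intro notI, elim disjE conjE; linarith)
      moreover have "\<not> (x = k \<and> y = 3 * k \<or> x = 3 * k \<and> y = k)"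
        using \<open>x = y \<or> x + y = B\<close> k by linarith
      ultimately show ?thesis unfolding fp prod.inject by blast
    next
      case ne: False
      then have "x' = tent B x" "y' = tent B y" "x \<noteq> y" "x + y \<noteq> B"
        using xy' False ne by (auto simp: xy step_def tent_eq_iff)
      then show ?thesis using pos k
        unfolding fp tent_def prod.inject by (smt (verit))
    qed
  qed
  finally show ?thesis .
qed

section \<open>Residue classes modulo 5\<close>

lemma res_cong:
  assumes "5 dvd x - y \<or> 5 dvd x + y"
  shows "res1 x \<longleftrightarrow> res1 y" "res2 x \<longleftrightarrow> res2 y"
proof -
  have "x mod 5 = y mod 5 \<or> x mod 5 = (- y) mod 5"
    using assms mod_eq_dvd_iff[of x 5 y] mod_eq_dvd_iff[of x 5 "- y"] by auto
  then show "res1 x \<longleftrightarrow> res1 y" "res2 x \<longleftrightarrow> res2 y"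
    by (auto simp: res1_def res2_def zmod_zminus1_eq_if split: if_splits)
qed

lemma res_double: "res1 (2 * x) \<longleftrightarrow> res2 x" "res2 (2 * x) \<longleftrightarrow> res1 x"
  unfolding res1_def res2_def by presburger+

lemma res_tent:
  assumes "5 dvd B"
  shows "res1 (tent B x) \<longleftrightarrow> res2 x" "res2 (tent B x) \<longleftrightarrow> res1 x"
proof -
  have "5 dvd tent B x - 2 * x \<or> 5 dvd tent B x + 2 * x"
    using assms by (auto simp: tent_def abs_if)
  then show "res1 (tent B x) \<longleftrightarrow> res2 x" "res2 (tent B x) \<longleftrightarrow> res1 x"
    by (simp_all add: res_cong res_double)
qed

lemma res_exhaust: "5 dvd x \<or> res1 x \<or> res2 x"
  unfolding res1_def res2_def by presburger

lemma res_disjoint: "res1 x \<Longrightarrow> \<not> res2 x" "res1 x \<Longrightarrow> \<not> 5 dvd x" "res2 x \<Longrightarrow> \<not> 5 dvd x"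
  unfolding res1_def res2_def by presburger+

lemma pow2_mod_5:
  "(2::int) ^ n mod 5 = (if n mod 4 = 0 then 1 else if n mod 4 = 1 then 2 else if n mod 4 = 2 then 4 else 3)"
proof (induction n rule: less_induct)
  case (less n)
  show ?case
  proof (cases "n < 4")
    case True
    then have "n = 0 \<or> n = 1 \<or> n = 2 \<or> n = 3" by auto
    then show ?thesis by auto
  next
    case False
    then obtain k where k: "n = k + 4" by (metis add.commute le_Suc_ex not_less)
    have "(2::int) ^ n mod 5 = (2 ^ k * 16) mod 5" by (simp add: k power_add)
    also have "\<dots> = 2 ^ k mod 5" by presburger
    finally show ?thesis using less[of k] by (simp add: k)
  qed
qed

section \<open>Bases \<open>5 * 2 ^ n\<close>\<close>

locale base_5_pow_2 =
  fixes n :: nat and B :: int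
  assumes n_pos: "n \<ge> 1" and B_def: "B = 5 * 2 ^ n"
begin

lemma B: "5 dvd B" "B > 0" "even B"
  using n_pos by (auto simp: B_def)

lemma tent_mult_pow_2: "tent B (c * 2 ^ n) = \<bar>5 - 2 * c\<bar> * 2 ^ n" "tent B (2 ^ n) = 3 * 2 ^ n"
proof -
  have "tent B (c * 2 ^ n) = \<bar>(5 - 2 * c) * 2 ^ n\<bar>" for c
    by (simp add: tent_def B_def algebra_simps)
  then have *: "tent B (c * 2 ^ n) = \<bar>5 - 2 * c\<bar> * 2 ^ n" for c
    by (simp add: abs_mult)
  from *[of c] *[of 1] show "tent B (c * 2 ^ n) = \<bar>5 - 2 * c\<bar> * 2 ^ n" "tent B (2 ^ n) = 3 * 2 ^ n"
    by simp_all
qed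

text \<open>After \<open>2 ^ Suc j\<close> is divided out, a tent step sends the cofactor
  \<open>w\<close> to the absolute value of \<open>5 * 2 ^ d - w\<close> with
  \<open>d = n - Suc j\<close>. Modulo 5 this only changes the sign. The parity is kept until the
  last step, \<open>d = 0\<close>, which flips it.\<close>

lemma tent_funpow:
  assumes "j \<le> n"
  shows "\<exists>w. (tent B ^^ j) x = 2 ^ j * w \<and> (odd w \<longleftrightarrow> (odd x \<longleftrightarrow> j < n))
    \<and> (res1 w \<longleftrightarrow> res1 x) \<and> (res2 w \<longleftrightarrow> res2 x)"
  using assms
proof (induction j)
  case 0
  then show ?case using n_pos by (intro exI[of _ x]) auto
next
  case (Suc j)
  then obtain w where w: "(tent B ^^ j) x = 2 ^ j * w" "odd w \<longleftrightarrow> odd x"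
    "res1 w \<longleftrightarrow> res1 x" "res2 w \<longleftrightarrow> res2 x" by auto
  define d where "d = n - Suc j"
  have n: "n = j + Suc d" using Suc.prems by (simp add: d_def)
  define w' where "w' = \<bar>5 * 2 ^ d - w\<bar>"
  have "(tent B ^^ Suc j) x = tent B (2 ^ j * w)" by (simp add: w(1))
  also have "\<dots> = \<bar>2 ^ Suc j * (5 * 2 ^ d - w)\<bar>"
    by (simp add: tent_def B_def n power_add algebra_simps)
  finally have "(tent B ^^ Suc j) x = \<bar>2 ^ Suc j * (5 * 2 ^ d - w)\<bar>" .
  then have "(tent B ^^ Suc j) x = 2 ^ Suc j * w'"
    by (simp only: abs_mult w'_def) simp
  moreover have "odd w' \<longleftrightarrow> (odd x \<longleftrightarrow> Suc j < n)"
    using w(2) by (cases d) (auto simp: w'_def n)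
  moreover have "5 dvd w' - w \<or> 5 dvd w' + w"
    by (auto simp: w'_def abs_if)
  then have "(res1 w' \<longleftrightarrow> res1 x) \<and> (res2 w' \<longleftrightarrow> res2 x)"
    unfolding w(3,4)[symmetric] by (simp add: res_cong[of w' w])
  ultimately show ?case by blast
qed

lemma tent_funpow_bounds: "0 \<le> x \<Longrightarrow> x \<le> B \<Longrightarrow> 0 \<le> (tent B ^^ j) x \<and> (tent B ^^ j) x \<le> B"
  by (induction j) (auto simp: tent_def)

lemma tent_funpow_n:
  assumes "0 \<le> x" "x \<le> B"
  shows "\<exists>r\<in>{0..5}. (tent B ^^ n) x = 2 ^ n * r \<and> (odd r \<longleftrightarrow> even x)
    \<and> (res1 r \<longleftrightarrow> res1 x) \<and> (res2 r \<longleftrightarrow> res2 x)"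
proof -
  obtain r where r: "(tent B ^^ n) x = 2 ^ n * r" "odd r \<longleftrightarrow> even x" "res1 r \<longleftrightarrow> res1 x" "res2 r \<longleftrightarrow> res2 x"
    using tent_funpow[of n x] by auto
  have "0 \<le> 2 ^ n * r" "2 ^ n * r \<le> 2 ^ n * 5"
    using tent_funpow_bounds[OF assms, of n] unfolding r(1) by (simp_all add: B_def)
  then have "r \<in> {0..5}" by (simp add: zero_le_mult_iff mult_le_cancel_left)
  with r show ?thesis by blast
qed

lemma tent_funpow_n_res1:
  assumes "0 \<le> x" "x \<le> B" "res1 x"
  shows "(tent B ^^ n) x = (if even x then 2 ^ n else 4 * 2 ^ n)"
proof -
  obtain r where r: "r \<in> {0..5}" "(tent B ^^ n) x = 2 ^ n * r" "odd r \<longleftrightarrow> even x" "res1 r"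
    using tent_funpow_n[OF assms(1,2)] assms(3) by auto
  have "r \<in> {1, 4}" using r(1,4) unfolding res1_def atLeastAtMost_iff by (simp, presburger)
  then show ?thesis using r by auto
qed

lemma tent_funpow_n_res2:
  assumes "0 \<le> x" "x \<le> B" "res2 x"
  shows "(tent B ^^ n) x = (if even x then 3 * 2 ^ n else 2 * 2 ^ n)"
proof -
  obtain r where r: "r \<in> {0..5}" "(tent B ^^ n) x = 2 ^ n * r" "odd r \<longleftrightarrow> even x" "res2 r"
    using tent_funpow_n[OF assms(1,2)] assms(3) by auto
  have "r \<in> {2, 3}" using r(1,4) unfolding res2_def atLeastAtMost_iff by (simp, presburger)
  then show ?thesis using r by auto
qed

text \<open>After \<open>n\<close> steps the parity of \<open>x\<close> still selects one of two
  multiples of \<open>2 ^ n\<close>; these have sum \<open>B\<close>, so the next step merges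
  them.\<close>

lemma tent_funpow_Suc_n:
  assumes "0 \<le> x" "x \<le> B"
  shows "res1 x \<Longrightarrow> tent B ((tent B ^^ n) x) = 3 * 2 ^ n" "res2 x \<Longrightarrow> tent B ((tent B ^^ n) x) = 2 ^ n"
  using assms by (cases "even x"; simp add: tent_funpow_n_res1 tent_funpow_n_res2 tent_mult_pow_2)+

lemma tent_funpow_n_odd_dvd:
  assumes "0 \<le> x" "x \<le> B" "odd x" "5 dvd x"
  shows "(tent B ^^ n) x = 0"
proof -
  obtain r where r: "r \<in> {0..5}" "(tent B ^^ n) x = 2 ^ n * r" "odd r \<longleftrightarrow> even x" "\<not> res1 r" "\<not> res2 r"
    using tent_funpow_n[OF assms(1,2)] assms(4) res_disjoint(2,3)[of x] by blast
  have "5 dvd r" using r(4,5) res_exhaust by blast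
  then have "r = 0" using r(1,3) assms(3) unfolding atLeastAtMost_iff by presburger
  then show ?thesis using r by auto
qed

lemma res_funpow_tent:
  "res1 x \<or> res2 x \<longleftrightarrow> res1 ((tent B ^^ j) x) \<or> res2 ((tent B ^^ j) x)"
  by (induction j) (auto simp: res_tent[OF B(1)])

lemma res_nonzero: "res1 x \<or> res2 x \<Longrightarrow> x \<noteq> 0"
  by (auto simp: res1_def res2_def)

text \<open>The odd cofactors keep the iterates of \<open>x\<close> nonzero before step
  \<open>n\<close>. They stay multiples of 5 while those of \<open>y\<close> never are, so no
  coincidence occurs.\<close>

lemma leads_odd_dvd:
  assumes x: "0 < x" "x < B" "odd x" "5 dvd x" and y: "res1 y \<or> res2 y"
  shows "leads B n (x, y) (0, (tent B ^^ n) y)"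
proof -
  have "leads B n (x, y) ((tent B ^^ n) x, (tent B ^^ n) y)"
  proof (rule leads_tent_funpow)
    fix j assume "j < n"
    then obtain w where "(tent B ^^ j) x = 2 ^ j * w" "odd w"
      using tent_funpow[of j x] x by auto
    then show "(tent B ^^ j) x \<noteq> 0 \<and> (tent B ^^ j) y \<noteq> 0"
      using y res_funpow_tent[of y j] res_nonzero by auto
  next
    fix j
    show "(tent B ^^ j) x \<noteq> (tent B ^^ j) y"
      using y x(4) res_funpow_tent res_disjoint by metis
  qed
  then show ?thesis using x tent_funpow_n_odd_dvd by simp
qed

text \<open>Cofactors of opposite parity keep the iterates apart for \<open>n\<close> steps. Being
  in the same class, they then coincide in the next one.\<close>

lemma leads_same_res:
  assumes x: "0 < x" "x < B" and y: "0 < y" "y < B" and odd: "odd (x + y)"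
    and res: "res1 x \<and> res1 y \<or> res2 x \<and> res2 y"
  defines "u \<equiv> (if res1 x then 3 * 2 ^ n else 2 ^ n)"
  shows "leads B (n + 1) (x, y) (u + 1, \<bar>u - 1\<bar>)"
proof -
  have "leads B n (x, y) ((tent B ^^ n) x, (tent B ^^ n) y)"
  proof (rule leads_tent_funpow)
    fix j assume "j < n"
    show "(tent B ^^ j) x \<noteq> 0 \<and> (tent B ^^ j) y \<noteq> 0"
      using res res_funpow_tent res_nonzero by blast
  next
    fix j assume "j \<le> n"
    then obtain v w where "(tent B ^^ j) x = 2 ^ j * v" "(tent B ^^ j) y = 2 ^ j * w" "odd v \<noteq> odd w"
      using tent_funpow[of j x] tent_funpow[of j y] odd by auto
    then show "(tent B ^^ j) x \<noteq> (tent B ^^ j) y" by auto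
  qed
  moreover have "leads B 1 ((tent B ^^ n) x, (tent B ^^ n) y) (u + 1, \<bar>u - 1\<bar>)"
  proof (rule leads_coincidence)
    show "(tent B ^^ n) x \<noteq> 0" "(tent B ^^ n) y \<noteq> 0"
      using res res_funpow_tent res_nonzero by blast+
    show "tent B ((tent B ^^ n) x) = u" "tent B ((tent B ^^ n) y) = u"
      using x y res res_disjoint(1) unfolding u_def
      by (auto simp: tent_funpow_Suc_n)
  qed
  ultimately show ?thesis using leads_trans by blast
qed

text \<open>The tent map exchanges the two classes, so such a pair stays of this kind and never
  meets an exceptional step.\<close>

definition opposite_res :: "int \<times> int \<Rightarrow> bool" where
  "opposite_res s \<longleftrightarrow> res1 (fst s) \<and> res2 (snd s) \<or> res2 (fst s) \<and> res1 (snd s)"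

lemma opposite_res_step:
  assumes "opposite_res (x, y)"
  shows "x \<noteq> 0" "y \<noteq> 0" "step B (x, y) = (tent B x, tent B y)" "opposite_res (tent B x, tent B y)"
proof -
  show *: "x \<noteq> 0" "y \<noteq> 0" using assms res_nonzero by (auto simp: opposite_res_def)
  show **: "opposite_res (tent B x, tent B y)"
    using assms by (auto simp: opposite_res_def res_tent[OF B(1)])
  then have "tent B x \<noteq> tent B y" using res_disjoint(1) by (auto simp: opposite_res_def)
  with * show "step B (x, y) = (tent B x, tent B y)" by (rule step_tent)
qed

lemma opposite_res_funpow:
  assumes "opposite_res (x, y)"
  shows "(step B ^^ j) (x, y) = ((tent B ^^ j) x, (tent B ^^ j) y) \<and> opposite_res ((step B ^^ j) (x, y))"
  by (induction j) (use assms in \<open>auto simp: opposite_res_step\<close>)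

lemma B_div_5: "B div 5 = 2 ^ n"
  by (simp add: B_def)

lemma opposite_res_reaches:
  assumes "opposite_res (x, y)" "0 < x" "x < B" "0 < y" "y < B"
  shows "reaches B (n + 1) (x, y)"
proof -
  have "res1 x \<and> res2 y \<or> res2 x \<and> res1 y" using assms(1) by (simp add: opposite_res_def)
  then show ?thesis
    using assms(2-5) opposite_res_funpow[OF assms(1), of "n + 1"]
    unfolding reaches_def fixed_pair_def B_div_5
    by (auto simp: tent_funpow_Suc_n)
qed

text \<open>An odd \<open>x\<close> arrives after \<open>n\<close> steps at \<open>2 * 2 ^ n\<close>
  or \<open>4 * 2 ^ n\<close>, neither of which belongs to the fixed pair.\<close>

lemma opposite_res_not_reaches:
  assumes "opposite_res (x, y)" "0 < x" "x < B" "0 < y" "y < B" "odd x"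
  shows "\<not> reaches B n (x, y)"
proof -
  have "res1 x \<and> res2 y \<or> res2 x \<and> res1 y" using assms(1) by (simp add: opposite_res_def)
  then show ?thesis
    using assms(2-6) opposite_res_funpow[OF assms(1), of "n"]
    unfolding reaches_def fixed_pair_def B_div_5
    by (auto simp: tent_funpow_n_res1 tent_funpow_n_res2)
qed

end

section \<open>Orbits following an exceptional step\<close>

definition from_zero :: "int \<Rightarrow> int \<Rightarrow> int \<times> int" where
  "from_zero B x = (x - 1, B - x)"

text \<open>The outcome of a step in which both images are \<open>u\<close>, just as
  \<open>from_zero\<close> is the outcome of a step from \<open>(0, x)\<close>.\<close>

definition from_coincidence :: "int \<Rightarrow> int \<times> int" where
  "from_coincidence u = (u + 1, \<bar>u - 1\<bar>)"

definition first_reaches :: "int \<Rightarrow> nat \<Rightarrow> int \<times> int \<Rightarrow> bool" where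
  "first_reaches B t s \<longleftrightarrow> t > 0 \<and> reaches B t s \<and> \<not> reaches B (t - 1) s"

lemma first_reaches_leads:
  assumes "leads B j s s'" "first_reaches B t s'"
  shows "first_reaches B (j + t) s"
proof -
  obtain k where "t = Suc k" using assms(2) by (cases t) (auto simp: first_reaches_def)
  then show ?thesis using assms by (simp add: first_reaches_def leads_def flip: add_Suc_right)
qed

text \<open>The first step erases the reflection, hence at least one step is required.\<close>

lemma leads_reflect:
  assumes "x \<noteq> 0" "x \<noteq> B" "y \<noteq> 0"
  shows "leads B (Suc d) (B - x, y) s \<longleftrightarrow> leads B (Suc d) (x, y) s"
proof -
  have "step B (B - x, y) = step B (x, y)"
    using assms by (simp add: step_def tent_reflect)
  then show ?thesis by (simp add: leads_def reaches_Suc)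
qed

lemma tent_add:
  assumes "2 * \<bar>c\<bar> < tent B w"
  shows "tent B (w + c) = tent B w + (if 2 * w < B then - 2 * c else 2 * c)"
  using assms by (auto simp: tent_def abs_if split: if_splits)

lemma int_pow2_odd_decomp:
  fixes x :: int
  assumes "x > 0"
  obtains a z where "x = 2 ^ a * z" "odd z" "z > 0"
  using assms
proof (induction "nat x" arbitrary: x thesis rule: less_induct)
  case less
  show ?case
  proof (cases "odd x")
    case True
    then show ?thesis using less(2)[of 0 x] less(3) by simp
  next
    case False
    then obtain y where y: "x = 2 * y" by blast
    then obtain a z where "y = 2 ^ a * z" "odd z" "z > 0" using less(1)[of y] less(3) by auto
    then show ?thesis using less(2)[of "Suc a" z] y by simp
  qed
qed

lemma pow2_dvd_pow2_mult_odd: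
  fixes z :: int
  assumes "2 ^ i dvd 2 ^ a * z" "odd z"
  shows "i \<le> a"
proof -
  have "coprime (2 ^ i) z" using assms(2) by (simp add: coprime_left_2_iff_odd)
  then have "(2::int) ^ i dvd 2 ^ a" using assms(1) coprime_dvd_mult_left_iff by blast
  then show ?thesis by (simp add: dvd_power_iff)
qed

context base_5_pow_2
begin

text \<open>The tent map keeps the pair adjacent, with the gap \<open>c\<close> doubling, until the first coordinate is \<open>B div 2\<close>.\<close>

lemma leads_adjacent:
  assumes "n = a + Suc d" "odd z" "w = 5 * 2 ^ a * z" "0 < w" "w < B" "\<bar>c\<bar> = 2 ^ t" "t \<le> a"
  shows "leads B (Suc d) (w, w + c) (0, 2 ^ (t + Suc d))"
  using assms
proof (induction d arbitrary: a z w c t)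
  case 0
  have Bw: "B = 10 * 2 ^ a" using 0(1) by (simp add: B_def)
  have z: "0 < z" "z < 2" using 0(3,4,5) by (simp_all add: Bw zero_less_mult_iff)
  then have w: "w = 5 * 2 ^ a" using 0(3) by simp
  have "(2::int) ^ t \<le> 2 ^ a" using 0(7) by simp
  then have "\<bar>c\<bar> < w" unfolding 0(6) w using zero_less_power[of "2::int" a] by linarith
  then have "w + c \<noteq> 0" "c \<noteq> 0" using 0(6) by auto
  moreover have "tent B w = 0" "tent B (w + c) = 2 * 2 ^ t"
    using 0(6) by (auto simp: tent_def Bw w)
  ultimately show ?case using leads_tent[of w "w + c" B] 0(4) by simp
next
  case (Suc d)
  define v where "v = B - 2 * w"
  \<comment> \<open>\<open>z'\<close> is the odd cofactor of the next first coordinate. Being at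
    least 1, it keeps that coordinate larger than the doubled gap.\<close>
  define z' where "z' = \<bar>2 ^ Suc d - z\<bar>"
  have n: "n = Suc a + Suc d" using Suc.prems(1) by simp
  have "odd z'" using Suc.prems(2) by (simp add: z'_def)
  then have "z' \<ge> 1" unfolding z'_def by presburger
  have "v = 5 * 2 ^ Suc a * (2 ^ Suc d - z)"
    by (simp add: v_def B_def n Suc.prems(3) power_add algebra_simps)
  then have v: "\<bar>v\<bar> = 5 * 2 ^ Suc a * z'" by (simp add: abs_mult z'_def)
  have ta: "(2::int) ^ t \<le> 2 ^ a" using Suc.prems(7) by simp
  have "z > 0" using Suc.prems(3,4) by (simp add: zero_less_mult_iff)
  then have "w \<ge> 5 * 2 ^ a" using Suc.prems(3) by simp
  then have "w + c \<noteq> 0" using Suc.prems(6) ta zero_less_power[of "2::int" a] by linarith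
  have "\<bar>v\<bar> \<ge> 5 * 2 ^ Suc a" using v \<open>z' \<ge> 1\<close> by simp
  then have vc: "\<bar>v\<bar> > 2 * \<bar>c\<bar>"
    using ta Suc.prems(6) zero_less_power[of "2::int" a] unfolding power_Suc by linarith
  define c' where "c' = (if v > 0 then - 2 * c else 2 * c)"
  have tw: "tent B w = \<bar>v\<bar>" "tent B (w + c) = \<bar>v\<bar> + c'"
    using vc tent_add[of c B w] by (simp_all add: tent_def v_def c'_def)
  have "c \<noteq> 0" using Suc.prems(6) by auto
  then have "leads B 1 (w, w + c) (\<bar>v\<bar>, \<bar>v\<bar> + c')"
    using leads_tent[of w "w + c" B] \<open>w + c \<noteq> 0\<close> Suc.prems(4) by (simp add: tw c'_def split: if_splits)
  moreover have "leads B (Suc d) (\<bar>v\<bar>, \<bar>v\<bar> + c') (0, 2 ^ (Suc t + Suc d))"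
  proof (rule Suc.IH[OF n \<open>odd z'\<close> v])
    show "0 < \<bar>v\<bar>" using vc by simp
    show "\<bar>v\<bar> < B" using tent_bounds[of w B] Suc.prems(4,5) tw by simp
    show "\<bar>c'\<bar> = 2 ^ Suc t" using Suc.prems(6) by (auto simp: c'_def)
  qed (use Suc.prems(7) in simp)
  ultimately show ?case using leads_trans[of B 1] by simp
qed

text \<open>The pair stays symmetric about the iterates of \<open>w\<close> until these reach \<open>B div 2\<close>, where the two images coincide.\<close>

lemma leads_symmetric:
  assumes "n = a + Suc d" "odd z" "w = 5 * 2 ^ a * z" "0 < w" "w < B" "t \<le> a"
  shows "leads B (Suc d) (w + 2 ^ t, w - 2 ^ t) (from_coincidence (2 ^ (t + Suc d)))"
  using assms
proof (induction d arbitrary: a z w t)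
  case 0
  have Bw: "B = 10 * 2 ^ a" using 0(1) by (simp add: B_def)
  have z: "0 < z" "z < 2" using 0(3,4,5) by (simp_all add: Bw zero_less_mult_iff)
  then have w: "w = 5 * 2 ^ a" using 0(3) by simp
  have "(2::int) ^ t \<le> 2 ^ a" using 0(6) by simp
  then have "w - 2 ^ t > 0" "w + 2 ^ t > 0"
    unfolding w using zero_less_power[of "2::int" a] zero_less_power[of "2::int" t] by linarith+
  moreover have "tent B (w + 2 ^ t) = 2 ^ Suc t" "tent B (w - 2 ^ t) = 2 ^ Suc t"
    by (auto simp: tent_def Bw w)
  ultimately show ?case using leads_coincidence[of "w + 2 ^ t" "w - 2 ^ t" B "2 ^ Suc t"]
    by (simp add: from_coincidence_def)
next
  case (Suc d)
  define v where "v = B - 2 * w"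
  define z' where "z' = \<bar>2 ^ Suc d - z\<bar>"
  have n: "n = Suc a + Suc d" using Suc.prems(1) by simp
  have "odd z'" using Suc.prems(2) by (simp add: z'_def)
  then have "z' \<ge> 1" unfolding z'_def by presburger
  have "v = 5 * 2 ^ Suc a * (2 ^ Suc d - z)"
    by (simp add: v_def B_def n Suc.prems(3) power_add algebra_simps)
  then have v: "\<bar>v\<bar> = 5 * 2 ^ Suc a * z'" by (simp add: abs_mult z'_def)
  have ta: "(2::int) ^ t \<le> 2 ^ a" using Suc.prems(6) by simp
  have "z > 0" using Suc.prems(3,4) by (simp add: zero_less_mult_iff)
  then have "w \<ge> 5 * 2 ^ a" using Suc.prems(3) by simp
  then have nz: "w + 2 ^ t \<noteq> 0" "w - 2 ^ t \<noteq> 0"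
    using ta Suc.prems(4) zero_less_power[of "2::int" t] by linarith+
  have "\<bar>v\<bar> \<ge> 5 * 2 ^ Suc a" using v \<open>z' \<ge> 1\<close> by simp
  then have vc: "\<bar>v\<bar> > 2 * 2 ^ t"
    using ta zero_less_power[of "2::int" a] unfolding power_Suc by linarith
  have tw: "tent B (w + 2 ^ t) = \<bar>v\<bar> - 2 ^ Suc t \<and> tent B (w - 2 ^ t) = \<bar>v\<bar> + 2 ^ Suc t
      \<or> tent B (w + 2 ^ t) = \<bar>v\<bar> + 2 ^ Suc t \<and> tent B (w - 2 ^ t) = \<bar>v\<bar> - 2 ^ Suc t"
    using vc tent_add[of "2 ^ t" B w] tent_add[of "- (2 ^ t)" B w] by (simp add: tent_def v_def)
  then have "tent B (w + 2 ^ t) \<noteq> tent B (w - 2 ^ t)"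
    using zero_less_power[of "2::int" "Suc t"] by linarith
  from leads_tent[OF nz this] tw
  have "leads B 1 (w + 2 ^ t, w - 2 ^ t) (\<bar>v\<bar> + 2 ^ Suc t, \<bar>v\<bar> - 2 ^ Suc t)"
    by (elim disjE conjE) (simp_all add: leads_swap(1)[of B _ _ "\<bar>v\<bar> - 2 * 2 ^ t"])
  moreover have "leads B (Suc d) (\<bar>v\<bar> + 2 ^ Suc t, \<bar>v\<bar> - 2 ^ Suc t) (from_coincidence (2 ^ (Suc t + Suc d)))"
  proof (rule Suc.IH[OF n \<open>odd z'\<close> v])
    show "0 < \<bar>v\<bar>" using vc zero_less_power[of "2::int" t] by linarith
    show "\<bar>v\<bar> < B" using tent_bounds[of w B] Suc.prems(4,5) by (simp add: tent_def v_def)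
  qed (use Suc.prems(6) in simp)
  ultimately show ?case using leads_trans[of B 1] by simp
qed

lemma exponent_less:
  assumes "5 * 2 ^ a * z < B" "z > 0"
  shows "a < n"
proof -
  have "5 * 2 ^ a * 1 \<le> 5 * 2 ^ a * z" using assms(2) by (intro mult_left_mono) auto
  then have "5 * (2::int) ^ a < 5 * 2 ^ n" using assms(1) unfolding B_def by linarith
  then show ?thesis by simp
qed

text \<open>If \<open>x\<close> has residue \<open>r\<close>, then \<open>(x - 1, B - x)\<close> is
  congruent to \<open>(r - 1, - r)\<close>. So \<open>r = 2\<close> and \<open>r = 4\<close> give
  opposite classes, \<open>r = 3\<close> gives equal classes, and \<open>r = 1\<close> or
  \<open>r = 0\<close> makes one coordinate a multiple of 5. The next lemmas treat these
  cases.\<close>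

lemma from_zero_opposite_res:
  assumes "x mod 5 = 2 \<or> x mod 5 = 4"
  shows "opposite_res (from_zero B x)"
proof -
  have "(x - 1) mod 5 = (x mod 5 - 1) mod 5" "(B - x) mod 5 = (- (x mod 5)) mod 5"
    using B(1) by presburger+
  then show ?thesis using assms
    by (auto simp: opposite_res_def from_zero_def res1_def res2_def)
qed

lemma reaches_from_zero:
  assumes "0 < x" "x < B" "x mod 5 = 2 \<or> x mod 5 = 4"
  shows "reaches B (n + 1) (from_zero B x)"
    and "even x \<Longrightarrow> first_reaches B (n + 1) (from_zero B x)"
proof -
  have "x \<ge> 2" using assms by presburger
  note o = from_zero_opposite_res[OF assms(3), unfolded from_zero_def]
  show *: "reaches B (n + 1) (from_zero B x)"
    unfolding from_zero_def using opposite_res_reaches[OF o] assms \<open>x \<ge> 2\<close> by simp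
  show "first_reaches B (n + 1) (from_zero B x)" if "even x"
    using opposite_res_not_reaches[OF o] assms \<open>x \<ge> 2\<close> that *
    by (simp add: first_reaches_def from_zero_def)
qed

lemma leads_from_zero_mod_1:
  assumes "0 < x" "x < B" "even x" "x mod 5 = 1"
  shows "leads B (n + 1) (from_zero B x) (from_zero B (2 ^ n))"
proof -
  have "5 dvd x - 1" using assms(4) by presburger
  moreover have "(B - x) mod 5 = 4" using assms(4) B(1) by presburger
  then have "res1 (B - x)" by (simp add: res1_def)
  moreover have "x - 1 > 0" "even (B - x)" using assms B(3) by (presburger, simp)
  ultimately have "leads B n (x - 1, B - x) (0, 2 ^ n)"
    using leads_odd_dvd[of "x - 1" "B - x"] tent_funpow_n_res1[of "B - x"] assms by simp
  from leads_trans[OF this leads_zero[of "2 ^ n" B]] show ?thesis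
    by (simp add: from_zero_def)
qed

lemma leads_from_zero_mod_3:
  assumes "0 < x" "x < B" "x mod 5 = 3"
  shows "leads B (n + 1) (from_zero B x) (from_coincidence (2 ^ n))"
proof -
  have "(x - 1) mod 5 = 2" "(B - x) mod 5 = 2" "x - 1 > 0" using assms B(1) by presburger+
  then have "res2 (x - 1)" "res2 (B - x)" by (simp_all add: res2_def)
  moreover have "odd (x - 1 + (B - x))" using B(3) by simp
  ultimately show ?thesis
    using leads_same_res[of "x - 1" "B - x"] assms \<open>x - 1 > 0\<close> res_disjoint(1)[of "x - 1"]
    unfolding from_zero_def from_coincidence_def by (simp split: if_splits)
qed

text \<open>Reflecting the second coordinate turns both states into adjacent pairs \<open>x\<close>,
  \<open>x - 1\<close> and \<open>x\<close>, \<open>x + 1\<close>, to which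
  \<open>leads_adjacent\<close> applies with initial gap 1.\<close>

lemma leads_from_zero_dvd:
  assumes x: "x = 5 * 2 ^ a * z" "odd z" "0 < x" "x < B" "a < n"
  shows "leads B (Suc (n - a)) (from_zero B x) (from_zero B (2 ^ (n - a)))"
    and "x + 1 < B \<Longrightarrow> leads B (Suc (n - a)) (from_zero B (x + 1)) (from_zero B (2 ^ (n - a)))"
proof -
  obtain d where d: "n - a = Suc d" "n = a + Suc d" using assms(5) by (metis Suc_diff_Suc add_diff_inverse_nat less_imp_not_less)
  have "5 dvd x" using x(1) by simp
  then have "x \<ge> 5" using x(3) by presburger
  have zero: "leads B 1 (0, 2 ^ Suc d) (from_zero B (2 ^ Suc d))"
    using leads_zero[of "2 ^ Suc d" B] by (simp add: from_zero_def)
  have "leads B (Suc d) (x, x + -1) (0, 2 ^ (0 + Suc d))"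
    by (rule leads_adjacent[OF d(2) x(2,1,3,4)]) auto
  then have "leads B (Suc d) (x - 1, B - x) (0, 2 ^ Suc d)"
    using leads_reflect[of x B "x - 1" d] \<open>x \<ge> 5\<close> x(4) by (simp add: leads_swap(2)[of _ _ _ "x - 1"])
  from leads_trans[OF this zero]
  show "leads B (Suc (n - a)) (from_zero B x) (from_zero B (2 ^ (n - a)))"
    by (simp add: d from_zero_def)
  have "leads B (Suc d) (x, x + 1) (0, 2 ^ (0 + Suc d))"
    by (rule leads_adjacent[OF d(2) x(2,1,3,4)]) auto
  then have "leads B (Suc d) (x, B - (x + 1)) (0, 2 ^ Suc d)" if "x + 1 < B"
    using leads_reflect[of "x + 1" B x d] \<open>x \<ge> 5\<close> that by (simp add: leads_swap(2)[of _ _ _ x])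
  from leads_trans[OF this zero]
  show "leads B (Suc (n - a)) (from_zero B (x + 1)) (from_zero B (2 ^ (n - a)))" if "x + 1 < B"
    using that by (simp add: d from_zero_def)
qed

text \<open>One of \<open>u + 1\<close> and \<open>u - 1\<close> is an odd multiple of 5, which goes
  to 0; the other is odd and congruent to 2 or 3, so it goes to \<open>2 * 2 ^ n\<close>.\<close>

lemma leads_from_coincidence_res1:
  assumes "0 \<le> u" "u < B" "even u" "res1 u"
  shows "leads B (n + 1) (from_coincidence u) (from_zero B (2 * 2 ^ n))"
proof -
  have u: "u \<ge> 2" "u + 1 < B" using assms B(3) by (auto simp: res1_def; presburger)+
  have "leads B n (u + 1, u - 1) (0, 2 * 2 ^ n)"
  proof (cases "u mod 5 = 1")
    case True
    then have "5 dvd u - 1" "(u + 1) mod 5 = 2" by presburger+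
    then have "5 dvd u - 1" "res2 (u + 1)" by (auto simp: res2_def)
    then show ?thesis using leads_odd_dvd[of "u - 1" "u + 1"] tent_funpow_n_res2[of "u + 1"] u assms(3)
      by (simp add: leads_swap(2)[of _ _ _ "u - 1"])
  next
    case False
    then have "u mod 5 = 4" using assms(4) by (simp add: res1_def)
    then have "5 dvd u + 1" "(u - 1) mod 5 = 3" by presburger+
    then have "5 dvd u + 1" "res2 (u - 1)" by (auto simp: res2_def)
    then show ?thesis using leads_odd_dvd[of "u + 1" "u - 1"] tent_funpow_n_res2[of "u - 1"] u assms(3)
      by simp
  qed
  from leads_trans[OF this leads_zero[of "2 * 2 ^ n" B]] show ?thesis
    using u by (simp add: from_zero_def from_coincidence_def)
qed

lemma reaches_from_coincidence_res2:
  assumes "0 \<le> u" "u < B" "even u" "res2 u"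
  shows "first_reaches B (n + 1) (from_coincidence u)"
proof -
  have u: "u \<ge> 2" "u + 1 < B" using assms B(3) by (auto simp: res2_def; presburger)+
  have "(u + 1) mod 5 = (u mod 5 + 1) mod 5" "(u - 1) mod 5 = (u mod 5 - 1) mod 5" by presburger+
  then have o: "opposite_res (u + 1, u - 1)"
    using assms(4) by (auto simp: opposite_res_def res1_def res2_def)
  show ?thesis
    using opposite_res_reaches[OF o] opposite_res_not_reaches[OF o] u assms(3)
    by (simp add: first_reaches_def from_coincidence_def)
qed

end

text \<open>Counted in steps on states, hence one less than the value of
  \<open>kaprekar_M\<close>.\<close>

definition max_distance :: "nat \<Rightarrow> nat" where
  "max_distance n =
     (if n mod 4 = 0 then 4 * n + 5 else if n mod 4 = 3 then 5 * n + 5 else 3 * n + 4)"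

lemma mod_4_exhaust: "k mod 4 = 0 \<or> k mod 4 = 1 \<or> k mod 4 = 2 \<or> k mod 4 = (3::nat)"
  by presburger

section \<open>Upper bound for bases \<open>5 * 2 ^ n\<close>\<close>

context base_5_pow_2
begin

lemma res_pow2: "res1 (2 ^ j) \<longleftrightarrow> even j" "res2 (2 ^ j) \<longleftrightarrow> odd j"
proof (induction j)
  case 0
  { case 1 show ?case by (simp add: res1_def) }
  { case 2 show ?case by (simp add: res2_def) }
next
  case (Suc j)
  { case 1 show ?case using Suc by (simp add: res_double) }
  { case 2 show ?case using Suc by (simp add: res_double) }
qed

lemma pow2_bounds: "0 < (2::int) ^ n" "2 ^ n < B" "even ((2::int) ^ n)" "2 * 2 ^ n < B"
  "j \<le> n \<Longrightarrow> 2 ^ j < B"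
proof -
  show "0 < (2::int) ^ n" "2 ^ n < B" "even ((2::int) ^ n)" "2 * 2 ^ n < B"
    using n_pos by (simp_all add: B_def)
  show "2 ^ j < B" if "j \<le> n"
    using power_increasing[OF that, of "2::int"] \<open>2 ^ n < B\<close> by linarith
qed

lemma odd_notin_fixed_pair: "odd x \<Longrightarrow> (x, y) \<notin> fixed_pair B"
  using n_pos by (auto simp: fixed_pair_def B_div_5)

lemma from_zero_even_notin_fixed_pair: "even x \<Longrightarrow> from_zero B x \<notin> fixed_pair B"
  unfolding from_zero_def by (rule odd_notin_fixed_pair) simp

lemma two_pow2_mod_5: "(2 * 2 ^ n :: int) mod 5 = (if n mod 4 = 0 then 2 else if n mod 4 = 1 then 4
    else if n mod 4 = 2 then 3 else 1)"
proof -
  have "(2 * 2 ^ n :: int) mod 5 = (2 * (2 ^ n mod 5)) mod 5" by (simp add: mod_mult_right_eq)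
  then show ?thesis by (simp add: pow2_mod_5)
qed

text \<open>This and the next two lemmas form the transition table of the three recurring states.
  The longest chain occurs for \<open>n mod 4 = 3\<close>; the loops occur for
  \<open>n mod 4 = 0\<close> and \<open>n mod 4 = 2\<close>.\<close>

lemma from_zero_2_pow2:
  "n mod 4 = 0 \<or> n mod 4 = 1 \<Longrightarrow> first_reaches B (n + 1) (from_zero B (2 * 2 ^ n))"
  "n mod 4 = 2 \<Longrightarrow> leads B (n + 1) (from_zero B (2 * 2 ^ n)) (from_coincidence (2 ^ n))"
  "n mod 4 = 3 \<Longrightarrow> leads B (n + 1) (from_zero B (2 * 2 ^ n)) (from_zero B (2 ^ n))"
  using reaches_from_zero(2)[of "2 * 2 ^ n"] leads_from_zero_mod_3[of "2 * 2 ^ n"]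
    leads_from_zero_mod_1[of "2 * 2 ^ n"] pow2_bounds two_pow2_mod_5 by auto

lemma from_zero_pow2:
  "n mod 4 = 0 \<Longrightarrow> leads B (n + 1) (from_zero B (2 ^ n)) (from_zero B (2 ^ n))"
  "n mod 4 = 1 \<or> n mod 4 = 2 \<Longrightarrow> first_reaches B (n + 1) (from_zero B (2 ^ n))"
  "n mod 4 = 3 \<Longrightarrow> leads B (n + 1) (from_zero B (2 ^ n)) (from_coincidence (2 ^ n))"
  using reaches_from_zero(2)[of "2 ^ n"] leads_from_zero_mod_3[of "2 ^ n"]
    leads_from_zero_mod_1[of "2 ^ n"] pow2_bounds pow2_mod_5[of n] by auto

lemma from_coincidence_pow2:
  "even n \<Longrightarrow> leads B (n + 1) (from_coincidence (2 ^ n)) (from_zero B (2 * 2 ^ n))"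
  "odd n \<Longrightarrow> first_reaches B (n + 1) (from_coincidence (2 ^ n))"
  using leads_from_coincidence_res1[of "2 ^ n"] reaches_from_coincidence_res2[of "2 ^ n"]
    pow2_bounds res_pow2 by auto

lemmas reaches_by_leads_B = reaches_by_leads[OF B(1,2)]
lemmas reaches_by_mono_B = reaches_by_mono[OF B(1,2)]
lemmas reaches_by_loop_B = reaches_by_loop[OF B(1,2)]

lemma first_reaches_imp_reaches_by: "first_reaches B t s \<Longrightarrow> reaches_by B t s"
  by (simp add: first_reaches_def reaches_imp_reaches_by)

text \<open>For \<open>n mod 4 = 2\<close> this state and \<open>from_zero B (2 * 2 ^ n)\<close>
  lead to each other forever, so the bound is vacuous.\<close>

lemma reaches_by_from_coincidence_pow2:
  "reaches_by B (if n mod 4 = 0 then 2 * n + 2 else n + 1) (from_coincidence (2 ^ n))"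
  (is "reaches_by B ?t _")
proof -
  have "odd n \<or> n mod 4 = 0 \<or> n mod 4 = 2" by presburger
  then consider "odd n" | "n mod 4 = 0" | "n mod 4 = 2" by metis
  then show ?thesis
  proof cases
    case 1
    then have "n mod 4 \<noteq> 0" by presburger
    then show ?thesis
      using first_reaches_imp_reaches_by[OF from_coincidence_pow2(2)[OF 1]] by simp
  next
    case 2
    then have "even n" by presburger
    then show ?thesis using reaches_by_leads_B[OF from_coincidence_pow2(1)
          first_reaches_imp_reaches_by[OF from_zero_2_pow2(1)]] 2 by simp
  next
    case 3
    then have "even n" by presburger
    note l = leads_trans[OF from_coincidence_pow2(1)[OF this] from_zero_2_pow2(2)[OF 3]]
    have "from_coincidence (2 ^ n) \<notin> fixed_pair B"
      unfolding from_coincidence_def by (rule odd_notin_fixed_pair) (use n_pos in simp)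
    with l show ?thesis using reaches_by_loop_B[of "n + 1 + n"] by simp
  qed
qed

lemma reaches_by_from_zero_pow2:
  "reaches_by B (if n mod 4 = 3 then 2 * n + 2 else n + 1) (from_zero B (2 ^ n))"
proof -
  consider "n mod 4 = 0" | "n mod 4 = 1 \<or> n mod 4 = 2" | "n mod 4 = 3"
    using mod_4_exhaust[of n] by metis
  then show ?thesis
  proof cases
    case 1
    have "from_zero B (2 ^ n) \<notin> fixed_pair B"
      using from_zero_even_notin_fixed_pair pow2_bounds by simp
    then show ?thesis using reaches_by_loop_B[of n] from_zero_pow2(1)[OF 1] by simp
  next
    case 2
    then have "n mod 4 \<noteq> 3" by auto
    then show ?thesis using first_reaches_imp_reaches_by[OF from_zero_pow2(2)[OF 2]] by simp
  next
    case 3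
    then show ?thesis using reaches_by_leads_B[OF from_zero_pow2(3)[OF 3]
        reaches_by_from_coincidence_pow2] by simp
  qed
qed

lemma reaches_by_from_zero_2_pow2:
  "reaches_by B (if n mod 4 = 3 then 3 * n + 3 else n + 1) (from_zero B (2 * 2 ^ n))"
proof -
  consider "n mod 4 = 0 \<or> n mod 4 = 1" | "n mod 4 = 2" | "n mod 4 = 3"
    using mod_4_exhaust[of n] by metis
  then show ?thesis
  proof cases
    case 1
    then have "n mod 4 \<noteq> 3" by auto
    then show ?thesis using first_reaches_imp_reaches_by[OF from_zero_2_pow2(1)[OF 1]] by simp
  next
    case 2
    then have "even n" by presburger
    note l = leads_trans[OF from_zero_2_pow2(2)[OF 2] from_coincidence_pow2(1)[OF this]]
    have "from_zero B (2 * 2 ^ n) \<notin> fixed_pair B"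
      using from_zero_even_notin_fixed_pair by simp
    with l show ?thesis using reaches_by_loop_B[of "n + 1 + n"] by simp
  next
    case 3
    then show ?thesis using reaches_by_leads_B[OF from_zero_2_pow2(3)[OF 3]
        reaches_by_from_zero_pow2] by simp
  qed
qed

lemma max_distance_ge:
  "max_distance n \<ge> 3 * n + 4" "n mod 4 = 0 \<Longrightarrow> max_distance n = 4 * n + 5"
  "n mod 4 = 3 \<Longrightarrow> max_distance n = 5 * n + 5"
  by (auto simp: max_distance_def)

text \<open>The bound is what remains for \<open>reaches_by_from_zero\<close> when
  \<open>n + 1 - a\<close> steps have led to \<open>j = n - a\<close>.\<close>

lemma reaches_by_from_zero_pow2_le:
  assumes j: "1 \<le> j" "j \<le> n"
  shows "reaches_by B (max_distance n - n - 2) (from_zero B (2 ^ j))"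
proof -
  have b: "0 < (2::int) ^ j" "2 ^ j < B" "even ((2::int) ^ j)" using pow2_bounds j by auto
  consider "j mod 4 = 1 \<or> j mod 4 = 2" | "j mod 4 = 0" | "j mod 4 = 3"
    using mod_4_exhaust[of j] by metis
  then show ?thesis
  proof cases
    case 1
    then have "(2::int) ^ j mod 5 = 2 \<or> (2::int) ^ j mod 5 = 4" by (auto simp: pow2_mod_5)
    then show ?thesis
      using reaches_by_mono_B[OF reaches_imp_reaches_by[OF reaches_from_zero(1)[OF b(1,2)]]]
        max_distance_ge(1) n_pos by simp
  next
    case 2
    then have "(2::int) ^ j mod 5 = 1" by (simp add: pow2_mod_5)
    then show ?thesis
      using reaches_by_leads_B[OF leads_from_zero_mod_1[OF b] reaches_by_from_zero_pow2]
        max_distance_ge by (cases "n mod 4 = 3"; cases "n mod 4 = 0"; simp)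
  next
    case 3
    then have "(2::int) ^ j mod 5 = 3" by (simp add: pow2_mod_5)
    then show ?thesis
      using reaches_by_leads_B[OF leads_from_zero_mod_3[OF b(1,2)] reaches_by_from_coincidence_pow2]
        max_distance_ge by (cases "n mod 4 = 3"; cases "n mod 4 = 0"; simp)
  qed
qed

text \<open>The exponent \<open>i\<close> stands for the tent steps made before the exceptional one,
  each of which contributed a factor 2; the further 1 is the exceptional step itself.\<close>

lemma reaches_by_from_zero:
  assumes x: "0 < x" "x < B" and i: "2 ^ i dvd x" "i \<le> n"
  shows "reaches_by B (max_distance n - i - 1) (from_zero B x)"
proof -
  note ge = max_distance_ge
  have "5 dvd x \<or> x mod 5 = 1 \<or> x mod 5 = 2 \<or> x mod 5 = 3 \<or> x mod 5 = 4" by presburger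
  moreover have "x = 1 \<or> x > 1" using x(1) by linarith
  ultimately consider "x mod 5 = 2 \<or> x mod 5 = 4" | "5 dvd x" | "x mod 5 = 3"
    | "x mod 5 = 1" "even x" | "x = 1" | "x mod 5 = 1" "odd x" "x > 1"
    by blast
  then show ?thesis
  proof cases
    case 1
    then show ?thesis
      using reaches_by_mono_B[OF reaches_imp_reaches_by[OF reaches_from_zero(1)[OF x]]] ge(1) i(2) n_pos
      by simp
  next
    case 2
    then obtain y where y: "x = 5 * y" by blast
    with x(1) obtain a z where z: "y = 2 ^ a * z" "odd z" "z > 0" using int_pow2_odd_decomp[of y] by auto
    have xz: "x = 5 * 2 ^ a * z" by (simp add: y z(1))
    have "a < n" using exponent_less[of a z] x(2) z(3) xz by simp
    have "2 ^ i dvd 2 ^ a * (5 * z)" using i(1) by (simp add: xz mult_ac)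
    then have "i \<le> a" using pow2_dvd_pow2_mult_odd z(2) by simp
    have "reaches_by B (max_distance n - n - 2) (from_zero B (2 ^ (n - a)))"
      using reaches_by_from_zero_pow2_le[of "n - a"] \<open>a < n\<close> by simp
    then show ?thesis
      using reaches_by_leads_B[OF leads_from_zero_dvd(1)[OF xz z(2) x \<open>a < n\<close>]] \<open>i \<le> a\<close> \<open>a < n\<close> ge(1) by simp
  next
    case 3
    then show ?thesis
      using reaches_by_leads_B[OF leads_from_zero_mod_3[OF x] reaches_by_from_coincidence_pow2] i(2) ge by (cases "n mod 4 = 3"; cases "n mod 4 = 0"; simp)
  next
    case 4
    then show ?thesis
      using reaches_by_leads_B[OF leads_from_zero_mod_1[OF x] reaches_by_from_zero_pow2] i(2) ge by (cases "n mod 4 = 3"; cases "n mod 4 = 0"; simp)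
  next
    case 5
    \<comment> \<open>\<open>from_zero B 1\<close> is \<open>(0, B - 1)\<close>, so a second
      exceptional step follows at once.\<close>
    then have "i = 0" using i(1) by (metis odd_one dvd_power dvd_trans gr0I)
    have "B \<ge> 10" using n_pos power_increasing[of 1 n "2::int"] by (simp add: B_def)
    then have l: "leads B 1 (from_zero B x) (from_zero B (B - 1))"
      using leads_zero[of "B - 1" B] by (simp add: from_zero_def 5)
    have "(B - 1) mod 5 = 4" using B(1) by presburger
    then have "reaches_by B (n + 1) (from_zero B (B - 1))"
      using reaches_imp_reaches_by[OF reaches_from_zero(1)[of "B - 1"]] \<open>B \<ge> 10\<close> by simp
    then show ?thesis using reaches_by_leads_B[OF l] \<open>i = 0\<close> ge(1) n_pos by simp
  next
    case 6
    then have "i = 0" using i(1) by (cases i) auto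
    \<comment> \<open>Here \<open>x - 1\<close> is an even multiple of 5, so after reflection the
      state is the adjacent pair \<open>x - 1\<close>, \<open>x\<close>.\<close>
    have "10 dvd x - 1" using 6 by presburger
    then obtain y where y: "x - 1 = 10 * y" by blast
    with 6(3) obtain a z where z: "y = 2 ^ a * z" "odd z" "z > 0" using int_pow2_odd_decomp[of y] by auto
    have xz: "x - 1 = 5 * 2 ^ Suc a * z" by (simp add: y z(1))
    have "Suc a < n" using exponent_less[of "Suc a" z] x(2) z(3) xz by simp
    have "reaches_by B (max_distance n - n - 2) (from_zero B (2 ^ (n - Suc a)))"
      using reaches_by_from_zero_pow2_le[of "n - Suc a"] \<open>Suc a < n\<close> by simp
    moreover have "leads B (Suc (n - Suc a)) (from_zero B x) (from_zero B (2 ^ (n - Suc a)))"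
      using leads_from_zero_dvd(2)[OF xz z(2) _ _ \<open>Suc a < n\<close>] x 6(3) by simp
    ultimately show ?thesis
      using reaches_by_leads_B[of "Suc (n - Suc a)"] \<open>Suc a < n\<close> \<open>i = 0\<close> ge(1) by simp
  qed
qed

text \<open>\<open>u\<close> is a tent value, so it gains a factor 2 over its argument, but it is
  only guaranteed the \<open>n\<close> factors 2 present in \<open>B\<close>; hence the
  minimum.\<close>

lemma reaches_by_from_coincidence:
  assumes u: "0 \<le> u" "u < B" "even u" and i: "2 ^ min (Suc i) n dvd u" "i \<le> n"
  shows "reaches_by B (max_distance n - i - 1) (from_coincidence u)"
proof -
  note ge = max_distance_ge
  consider "u = 0" | "res1 u" | "res2 u" | "5 dvd u" "u > 0" using res_exhaust[of u] u(1) by fastforce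
  then show ?thesis
  proof cases
    case 1
    have "B \<ge> 10" using n_pos power_increasing[of 1 n "2::int"] by (simp add: B_def)
    \<comment> \<open>The state is \<open>(1, 1)\<close>, whose images coincide once more, at
      \<open>B - 2\<close>.\<close>
    then have l: "leads B 1 (from_coincidence u) (B - 1, B - 3)"
      using leads_coincidence[of 1 1 B "B - 2"] by (simp add: from_coincidence_def 1 tent_def)
    have "(B - 1) mod 5 = 4" "(B - 3) mod 5 = 2" using B(1) by presburger+
    then have "opposite_res (B - 1, B - 3)" by (simp add: opposite_res_def res1_def res2_def)
    then have "reaches_by B (n + 1) (B - 1, B - 3)"
      using reaches_imp_reaches_by[OF opposite_res_reaches] \<open>B \<ge> 10\<close> by simp
    then show ?thesis using reaches_by_leads_B[OF l] i(2) ge(1) n_pos by simp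
  next
    case 2
    then show ?thesis
      using reaches_by_leads_B[OF leads_from_coincidence_res1[OF u] reaches_by_from_zero_2_pow2] i(2) ge
      by (cases "n mod 4 = 3"; cases "n mod 4 = 0"; simp)
  next
    case 3
    then show ?thesis
      using reaches_by_mono_B[OF first_reaches_imp_reaches_by[OF reaches_from_coincidence_res2[OF u]]]
        i(2) ge(1) n_pos by simp
  next
    case 4
    then obtain y where y: "u = 5 * y" by blast
    with 4 obtain a z where z: "y = 2 ^ a * z" "odd z" "z > 0" using int_pow2_odd_decomp[of y] by auto
    have uz: "u = 5 * 2 ^ a * z" by (simp add: y z(1))
    have "a < n" using exponent_less[of a z] u(2) z(3) uz by simp
    then obtain d where d: "n = a + Suc d" by (metis add_Suc_right less_imp_Suc_add)
    have "2 ^ min (Suc i) n dvd 2 ^ a * (5 * z)" using i(1) by (simp add: uz mult_ac)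
    then have "min (Suc i) n \<le> a" using pow2_dvd_pow2_mult_odd z(2) by simp
    then have "Suc i \<le> a" using \<open>a < n\<close> by simp
    have l: "leads B (Suc d) (from_coincidence u) (from_coincidence (2 ^ Suc d))"
      using leads_symmetric[OF d z(2) uz 4(2) u(2), of 0] 4 by (simp add: from_coincidence_def)
    have b: "0 \<le> (2::int) ^ Suc d" "2 ^ Suc d < B" "even ((2::int) ^ Suc d)" using pow2_bounds(5)[of "Suc d"] d by auto
    have "reaches_by B (if n mod 4 = 3 then 4 * n + 4 else 2 * n + 2) (from_coincidence (2 ^ Suc d))"
    proof (cases "even (Suc d)")
      case True
      then have "res1 (2 ^ Suc d)" using res_pow2 by blast
      then show ?thesis
        using reaches_by_leads_B[OF leads_from_coincidence_res1[OF b] reaches_by_from_zero_2_pow2] by simp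
    next
      case False
      then have "res2 (2 ^ Suc d)" using res_pow2 by blast
      then show ?thesis
        using reaches_by_mono_B[OF first_reaches_imp_reaches_by[OF reaches_from_coincidence_res2[OF b]]] by simp
    qed
    then show ?thesis using reaches_by_leads_B[OF l] \<open>Suc i \<le> a\<close> d ge by (simp split: if_splits)
  qed
qed

lemma tent_pow2_dvd: "2 ^ i dvd x \<Longrightarrow> 2 ^ min (Suc i) n dvd tent B x"
proof -
  assume "2 ^ i dvd x"
  then have "2 ^ Suc i dvd 2 * x" by simp
  moreover have "2 ^ min (Suc i) n dvd (2::int) ^ Suc i" "2 ^ min (Suc i) n dvd B"
    by (auto simp only: B_def intro!: dvd_mult le_imp_power_dvd)
  ultimately show ?thesis unfolding tent_def by (meson dvd_abs_iff dvd_diff dvd_trans)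
qed

lemma reaches_by_max_distance_event:
  assumes xy: "0 \<le> x" "x < B" "0 \<le> y" "y < B" and i: "2 ^ i dvd x" "2 ^ i dvd y" "i \<le> n"
    and event: "x = 0 \<or> y = 0 \<or> tent B x = tent B y"
  shows "reaches_by B (max_distance n - i) (x, y)"
proof -
  have md: "1 + (max_distance n - i - 1) \<le> max_distance n - i"
    using max_distance_ge(1) i(3) by simp
  consider "x = 0" "y = 0" | "x \<noteq> 0" "y = 0" | "x = 0" "y \<noteq> 0" | "x \<noteq> 0" "y \<noteq> 0" "tent B x = tent B y"
    using event by blast
  then show ?thesis
  proof cases
    case 1
    have "leads B (Suc 0) (0, 0) (0, 0)" using leads_step[of B "(0, 0)"] by (simp add: step_def)
    moreover have "(0, 0) \<notin> fixed_pair B" by (simp add: fixed_pair_def B_div_5)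
    ultimately show ?thesis using reaches_by_loop_B 1 by blast
  next
    case 2
    then show ?thesis using reaches_by_leads_B[OF leads_zero[of x B] _ md] reaches_by_from_zero[of x i] xy i
      by (simp add: from_zero_def reaches_by_swap[of _ _ x 0])
  next
    case 3
    then show ?thesis using reaches_by_leads_B[OF leads_zero[of y B] _ md] reaches_by_from_zero[of y i] xy i
      by (simp add: from_zero_def)
  next
    case 4
    have "even (tent B x)" using B(3) by (simp add: tent_def)
    then show ?thesis
      using reaches_by_leads_B[OF leads_coincidence[OF 4(1,2) refl 4(3)[symmetric]] _ md]
        reaches_by_from_coincidence[of "tent B x" i] tent_bounds[of x B] tent_pow2_dvd[OF i(1)] 4 xy i(3)
      by (simp add: from_coincidence_def)
  qed
qed

text \<open>Induction downwards from \<open>i = n\<close>: either the step is exceptional, or a tent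
  step raises the common power of 2.\<close>

lemma reaches_by_max_distance_diff:
  assumes "i \<le> n" "0 \<le> x" "x < B" "0 \<le> y" "y < B" "2 ^ i dvd x" "2 ^ i dvd y"
  shows "reaches_by B (max_distance n - i) (x, y)"
  using assms
proof (induction i arbitrary: x y rule: inc_induct)
  case base
  show ?case
  proof (cases "x = 0 \<or> y = 0 \<or> tent B x = tent B y")
    case True
    then show ?thesis using reaches_by_max_distance_event base by simp
  next
    case False
    obtain r s where rs: "x = 2 ^ n * r" "y = 2 ^ n * s" using base by (auto elim!: dvdE)
    have "r \<in> {1..4}" "s \<in> {1..4}" using False base
      by (auto simp: rs B_def zero_le_mult_iff mult_less_cancel_left)
    \<comment> \<open>This leaves one of 1 and 4 paired with one of 2 and 3, so the next step lands
      in the fixed pair.\<close>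
    moreover have "r \<noteq> s" "r + s \<noteq> 5"
      using False by (auto simp: rs tent_eq_iff B_def simp flip: distrib_left)
    ultimately have "(\<bar>5 - 2 * r\<bar>, \<bar>5 - 2 * s\<bar>) \<in> {(1, 3), (3, 1)}" by (simp; presburger)
    moreover have "tent B x = \<bar>5 - 2 * r\<bar> * 2 ^ n" "tent B y = \<bar>5 - 2 * s\<bar> * 2 ^ n"
      using tent_mult_pow_2(1) by (simp_all add: rs mult.commute[of "2 ^ n"])
    ultimately have "step B (x, y) \<in> fixed_pair B"
      using False by (auto simp: step_def fixed_pair_def B_div_5)
    then have "reaches B 1 (x, y)" by (simp add: reaches_def)
    then show ?thesis
      using reaches_by_mono_B[OF reaches_imp_reaches_by] max_distance_ge(1) by simp
  qed
next
  case (step i)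
  show ?case
  proof (cases "x = 0 \<or> y = 0 \<or> tent B x = tent B y")
    case True
    then show ?thesis using reaches_by_max_distance_event step by simp
  next
    case False
    then have "reaches_by B (max_distance n - Suc i) (tent B x, tent B y)"
      using step.IH[of "tent B x" "tent B y"] step.prems step.hyps
        tent_bounds[of x B] tent_bounds[of y B] tent_pow2_dvd[of i x] tent_pow2_dvd[of i y] by simp
    moreover have "1 + (max_distance n - Suc i) \<le> max_distance n - i"
      using max_distance_ge(1) step.hyps by simp
    ultimately show ?thesis
      using reaches_by_leads_B[OF leads_tent] False by blast
  qed
qed

lemma reaches_by_max_distance: "valid B s \<Longrightarrow> reaches_by B (max_distance n) s"
  using reaches_by_max_distance_diff[of 0 "fst s" "snd s"] by (simp add: valid_def)

end

section \<open>States at maximal distance, and scaling of orbits\<close>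

context base_5_pow_2
begin

text \<open>For each residue of \<open>n\<close> modulo 4 an explicit state enters the transition
  table as far from its end as possible. The segment lengths add up to
  \<open>max_distance n\<close>.\<close>

lemma first_reaches_max_distance:
  assumes "n \<ge> 3"
  shows "\<exists>p q. valid B (p, q) \<and> q \<le> p \<and> first_reaches B (max_distance n) (p, q)"
proof -
  have n: "(2::int) ^ n = 2 * 2 ^ (n - 1)" "(2::int) ^ (n - 1) = 2 * 2 ^ (n - 2)"
    using assms by (simp_all flip: power_Suc add: Suc_diff_Suc numeral_2_eq_2)
  have pow: "(2::int) ^ 2 \<le> 2 ^ (n - 1)" using assms by (intro power_increasing) auto
  note trans = first_reaches_leads
  \<comment> \<open>\<open>g\<close> is \<open>B div 2\<close>, so \<open>(g, g - 5)\<close> goes to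
    \<open>(0, 10)\<close>. Since \<open>10 = 5 * 2 ^ 1\<close>, the exponent \<open>n - 1\<close>
    arises.\<close>
  define g where "g = 5 * (2::int) ^ (n - 1)"
  have B2: "B = 2 * g" and g: "g \<ge> 20" using n pow by (simp_all add: B_def g_def)
  then have valid_g: "valid B (g, g - 5)" by (simp add: valid_def)
  have half: "leads B (n + 2) (g, g - 5) (from_zero B (2 ^ (n - 1)))"
  proof -
    have "leads B 1 (g, g - 5) (0, 10)"
      using leads_tent[of g "g - 5" B] g by (simp add: B2 tent_def)
    moreover have "leads B 1 (0, 10) (from_zero B 10)"
      using leads_zero[of 10 B] by (simp add: from_zero_def)
    moreover have "leads B n (from_zero B 10) (from_zero B (2 ^ (n - 1)))"
      using leads_from_zero_dvd(1)[of 10 1 1] g assms by (simp add: B2)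
    ultimately have "leads B (1 + 1 + n) (g, g - 5) (from_zero B (2 ^ (n - 1)))"
      using leads_trans by blast
    then show ?thesis by simp
  qed
  consider "n mod 4 = 0" | "n mod 4 = 1" | "n mod 4 = 2" | "n mod 4 = 3"
    using mod_4_exhaust[of n] by metis
  then show ?thesis
  proof cases
    assume "n mod 4 = 3"
    \<comment> \<open>Both 6 and 1 are congruent to 1 modulo 5 and they differ in parity, so their
      first coincidence is at \<open>3 * 2 ^ n\<close>.\<close>
    have 1: "leads B (n + 1) (6, 1) (from_coincidence (3 * 2 ^ n))"
      using leads_same_res[of 6 1] pow n by (simp add: B_def res1_def from_coincidence_def)
    have "(3 * 2 ^ n :: int) mod 5 = (3 * (2 ^ n mod 5)) mod 5" by (simp add: mod_mult_right_eq)
    then have "res1 (3 * 2 ^ n)" using \<open>n mod 4 = 3\<close> by (simp add: res1_def pow2_mod_5)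
    then have 2: "leads B (n + 1) (from_coincidence (3 * 2 ^ n)) (from_zero B (2 * 2 ^ n))"
      using leads_from_coincidence_res1[of "3 * 2 ^ n"] n_pos by (simp add: B_def)
    have "odd n" using \<open>n mod 4 = 3\<close> by presburger
    then have "first_reaches B (n + 1 + (n + 1 + (n + 1 + (n + 1 + (n + 1))))) (6, 1)"
      using trans[OF 1 trans[OF 2 trans[OF from_zero_2_pow2(3) trans[OF from_zero_pow2(3)]]]]
        from_coincidence_pow2(2) \<open>n mod 4 = 3\<close> by blast
    moreover have "valid B (6, 1)" using pow n by (simp add: valid_def B_def)
    moreover have "n + 1 + (n + 1 + (n + 1 + (n + 1 + (n + 1)))) = max_distance n"
      using \<open>n mod 4 = 3\<close> max_distance_ge(3) by simp
    moreover have "(1::int) \<le> 6" by simp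
    ultimately show ?thesis by metis
  next
    assume n2: "n mod 4 = 2"
    then have n6: "n \<ge> 6" using assms by presburger
    \<comment> \<open>Starting from \<open>g\<close> would give \<open>2 ^ (n - 1)\<close>,
      congruent to 2, which converges too early. A start near \<open>h = B div 4\<close> takes one
      more tent step, gives \<open>20 = 5 * 2 ^ 2\<close> and so \<open>2 ^ (n - 2)\<close>,
      congruent to 1.\<close>
    define h where "h = 5 * (2::int) ^ (n - 2)"
    have B4: "B = 4 * h" using n by (simp add: B_def h_def)
    have "(2::int) ^ 4 \<le> 2 ^ (n - 2)" using n6 by (intro power_increasing) auto
    then have h: "h \<ge> 80" by (simp add: h_def)
    have "leads B 1 (h + 5, h) (2 * h - 10, 2 * h)"
      using leads_tent[of "h + 5" h B] h by (simp add: B4 tent_def)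
    moreover have "leads B 1 (2 * h - 10, 2 * h) (20, 0)"
      using leads_tent[of "2 * h - 10" "2 * h" B] h by (simp add: B4 tent_def)
    moreover have "leads B 1 (20, 0) (from_zero B 20)"
      using leads_zero[of 20 B] by (simp add: from_zero_def leads_swap(2)[of B _ 20])
    moreover have "leads B (n - 1) (from_zero B 20) (from_zero B (2 ^ (n - 2)))"
      using leads_from_zero_dvd(1)[of 20 2 1] h n6 by (simp add: B4 Suc_diff_Suc numeral_2_eq_2)
    moreover have "(n - 2) mod 4 = 0" using n2 n6 by presburger
    then have "(2::int) ^ (n - 2) mod 5 = 1" by (simp add: pow2_mod_5)
    then have "leads B (n + 1) (from_zero B (2 ^ (n - 2))) (from_zero B (2 ^ n))"
      using leads_from_zero_mod_1[of "2 ^ (n - 2)"] pow2_bounds(5)[of "n - 2"] n6 by simp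
    ultimately have "first_reaches B (1 + (1 + (1 + (n - 1 + (n + 1 + (n + 1)))))) (h + 5, h)"
      using trans from_zero_pow2(2) n2 by metis
    moreover have "1 + (1 + (1 + (n - 1 + (n + 1 + (n + 1))))) = max_distance n"
      using n2 n6 by (simp add: max_distance_def)
    moreover have "valid B (h + 5, h)" using h by (simp add: valid_def B4)
    moreover have "h \<le> h + 5" by simp
    ultimately show ?thesis by metis
  next
    assume n01: "n mod 4 = 0"
    then have "Suc (n - 1) mod 4 = 0" using assms by simp
    then have "(n - 1) mod 4 = 3" by (simp only: mod_Suc split: if_splits)
    then have "(2::int) ^ (n - 1) mod 5 = 3" by (simp add: pow2_mod_5)
    then have "leads B (n + 1) (from_zero B (2 ^ (n - 1))) (from_coincidence (2 ^ n))"
      using leads_from_zero_mod_3[of "2 ^ (n - 1)"] pow2_bounds(5)[of "n - 1"] by simp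
    moreover have "even n" using n01 by presburger
    ultimately have "first_reaches B (n + 2 + (n + 1 + (n + 1 + (n + 1)))) (g, g - 5)"
      using trans half from_zero_2_pow2(1) from_coincidence_pow2(1) n01 by metis
    moreover have "n + 2 + (n + 1 + (n + 1 + (n + 1))) = max_distance n"
      using n01 by (simp add: max_distance_def)
    moreover have "g - 5 \<le> g" by simp
    ultimately show ?thesis using valid_g by metis
  next
    assume n01: "n mod 4 = 1"
    then have "Suc (n - 1) mod 4 = 1" using assms by simp
    then have "(n - 1) mod 4 = 0" by (simp only: mod_Suc split: if_splits)
    then have "(2::int) ^ (n - 1) mod 5 = 1" by (simp add: pow2_mod_5)
    then have "leads B (n + 1) (from_zero B (2 ^ (n - 1))) (from_zero B (2 ^ n))"
      using leads_from_zero_mod_1[of "2 ^ (n - 1)"] pow2_bounds(5)[of "n - 1"] assms by simp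
    then have "first_reaches B (n + 2 + (n + 1 + (n + 1))) (g, g - 5)"
      using trans half from_zero_pow2(2) n01 by metis
    moreover have "n + 2 + (n + 1 + (n + 1)) = max_distance n"
      using n01 by (simp add: max_distance_def)
    moreover have "g - 5 \<le> g" by simp
    ultimately show ?thesis using valid_g by metis
  qed
qed

lemma fixed_pair_mult: "m \<noteq> 0 \<Longrightarrow> (m * x, m * y) \<in> fixed_pair (m * B) \<longleftrightarrow> (x, y) \<in> fixed_pair B"
  by (auto simp: fixed_pair_def B_def)

text \<open>Scaling commutes with the tent map but not with exceptional steps, which
  \<open>opposite_res\<close> excludes.\<close>

lemma reaches_mult:
  assumes "opposite_res (x, y)" "m > 0"
  shows "reaches (m * B) t (m * x, m * y) \<longleftrightarrow> reaches B t (x, y)"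
  using assms(1)
proof (induction t arbitrary: x y)
  case 0
  show ?case using assms(2) by (simp add: reaches_0 fixed_pair_mult)
next
  case (Suc t)
  note o = opposite_res_step[OF Suc.prems]
  have tm: "tent (m * B) (m * z) = m * tent B z" for z
  proof -
    have "m * B - 2 * (m * z) = m * (B - 2 * z)" by (simp add: algebra_simps)
    then show ?thesis using assms(2) unfolding tent_def by (simp add: abs_mult)
  qed
  have "tent B x \<noteq> tent B y" using o(4) res_disjoint(1) by (auto simp: opposite_res_def)
  then have "step (m * B) (m * x, m * y) = (m * tent B x, m * tent B y)"
    using step_tent[of "m * x" "m * y" "m * B"] o(1,2) assms(2) by (simp add: tm)
  then show ?case using Suc.IH[OF o(4)] o(3) by (simp add: reaches_Suc)
qed

end

section \<open>Bases \<open>5 * m * 2 ^ n\<close> with odd \<open>m > 1\<close>\<close>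

lemma kaprekar_M_eq_distance:
  assumes b: "5 dvd b" "b > 0"
    and upper: "\<And>s. valid (int b) s \<Longrightarrow> reaches_by (int b) N s"
    and lower: "valid (int b) (p, q)" "q \<le> p" "first_reaches (int b) N (p, q)"
  shows "kaprekar_M b = N + 1"
proof -
  obtain k where N: "N = Suc k" using lower(3) by (cases N) (auto simp: first_reaches_def)
  have b': "b \<ge> 2" "5 dvd int b" "int b > 0" using b dvd_imp_le[of 5 b] by presburger+
  have fx: "fixed (int b) ((step (int b) ^^ t) s) \<longleftrightarrow> reaches (int b) t s" if "valid (int b) s" for s t
    using fixed_iff_fixed_pair[OF b'(2,3) valid_funpow_step[OF that]] by (simp add: reaches_def)
  have "kaprekar_M b = k + 2"
  proof (rule kaprekar_M_eqI[OF b'(1) _ lower(1,2)])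
    show "fixed (int b) ((step (int b) ^^ Suc k) s)"
      if "valid (int b) s" "fixed (int b) ((step (int b) ^^ t) s)" for s t
      using that upper unfolding fx[OF that(1)] reaches_by_def N by blast
    show "fixed (int b) ((step (int b) ^^ Suc k) (p, q))" "\<not> fixed (int b) ((step (int b) ^^ k) (p, q))"
      using lower(3) unfolding fx[OF lower(1)] first_reaches_def N by simp_all
  qed
  then show ?thesis by (simp add: N)
qed

locale base_5_odd_pow_2 =
  fixes n :: nat and m B :: int
  assumes m: "odd m" "m > 1" and B_def: "B = 5 * m * 2 ^ n"
begin

lemma B: "5 dvd B" "B > 0" "m dvd B" "B div 5 = m * 2 ^ n"
  using m by (auto simp: B_def)

lemma not_m_dvd_small: "\<not> m dvd 1" "\<not> m dvd 2"
proof -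
  show "\<not> m dvd 1" using m by auto
  have "coprime m 2" using m(1) by simp
  then show "\<not> m dvd 2" using \<open>\<not> m dvd 1\<close> by (metis coprime_common_divisor dvd_refl)
qed

text \<open>After a zero the coordinates add up to \<open>B - 1\<close>, and \<open>m\<close>
  divides \<open>B\<close>. After a coincidence they are, up to sign, two numbers that differ by 2,
  and \<open>m\<close> is odd.\<close>

lemma not_both_m_dvd_event:
  assumes "(x, y) \<noteq> (0, 0)" "x = 0 \<or> y = 0 \<or> tent B x = tent B y"
  shows "\<not> (m dvd fst (step B (x, y)) \<and> m dvd snd (step B (x, y)))"
proof -
  have zero: "\<not> (m dvd z - 1 \<and> m dvd B - z)" for z
  proof
    assume "m dvd z - 1 \<and> m dvd B - z"
    then have "m dvd B - ((z - 1) + (B - z))" using B(3) dvd_add dvd_diff by blast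
    then show False using not_m_dvd_small by simp
  qed
  have coin: "\<not> (m dvd z + 1 \<and> m dvd \<bar>z - 1\<bar>)" for z
  proof
    assume "m dvd z + 1 \<and> m dvd \<bar>z - 1\<bar>"
    then have "m dvd (z + 1) - (z - 1)" by (metis dvd_abs_iff dvd_diff)
    then show False using not_m_dvd_small by simp
  qed
  show ?thesis using zero coin assms by (auto simp: step_def)
qed

lemma m_dvd_tent: "m dvd tent B x \<longleftrightarrow> m dvd x"
proof -
  have "m dvd B - 2 * x \<longleftrightarrow> m dvd 2 * x" using B(3) by (metis dvd_diff_commute dvd_diff_right_iff)
  also have "\<dots> \<longleftrightarrow> m dvd x" using m(1) by (simp add: coprime_dvd_mult_right_iff)
  finally show ?thesis by (simp add: tent_def)
qed

text \<open>Failure of joint divisibility by \<open>m\<close> is invariant: tent steps preserve and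
  reflect divisibility, and exceptional steps destroy it. The fixed pair consists of multiples of
  \<open>m\<close>.\<close>

lemma not_reaches:
  assumes "\<not> (m dvd fst s \<and> m dvd snd s)"
  shows "\<not> reaches B t s"
  using assms
proof (induction t arbitrary: s)
  case 0
  then show ?case by (auto simp: reaches_0 fixed_pair_def B)
next
  case (Suc t)
  obtain x y where s: "s = (x, y)" by fastforce
  have "\<not> (m dvd fst (step B s) \<and> m dvd snd (step B s))"
  proof (cases "x = 0 \<or> y = 0 \<or> tent B x = tent B y")
    case True
    then show ?thesis using not_both_m_dvd_event[of x y] Suc.prems s by auto
  next
    case False
    then show ?thesis using Suc.prems by (simp add: s step_tent m_dvd_tent)
  qed
  then show ?case using Suc.IH by (simp add: reaches_Suc)
qed

text \<open>Vacuously true: \<open>(0, 0)\<close> stays put, and any other exceptional step leads to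
  a state excluded by \<open>not_reaches\<close>.\<close>

lemma reaches_by_event:
  assumes "x = 0 \<or> y = 0 \<or> tent B x = tent B y"
  shows "reaches_by B t (x, y)"
proof (cases "(x, y) = (0, 0)")
  case True
  have "leads B (Suc 0) (0, 0) (0, 0)" using leads_step[of B "(0, 0)"] by (simp add: step_def)
  moreover have "(0, 0) \<notin> fixed_pair B" using m by (simp add: fixed_pair_def B)
  ultimately show ?thesis using reaches_by_loop B True by metis
next
  case False
  then have "\<not> reaches B (Suc u) (x, y)" for u
    using not_reaches[OF not_both_m_dvd_event[OF False assms]] by (simp only: reaches_Suc) simp
  then have "\<not> reaches B u (x, y)" for u
    using reaches_mono[OF B(1,2), of u _ "Suc u"] by auto
  then show ?thesis by (simp add: reaches_by_def)
qed

text \<open>Each tent step gains a factor 2 until both coordinates are multiples of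
  \<open>B div 5\<close>, one step before the fixed pair.\<close>

lemma reaches_by_diff:
  assumes "i \<le> n" "0 \<le> x" "x < B" "0 \<le> y" "y < B" "m * 2 ^ i dvd x" "m * 2 ^ i dvd y"
  shows "reaches_by B (n + 1 - i) (x, y)"
  using assms
proof (induction i arbitrary: x y rule: inc_induct)
  case base
  show ?case
  proof (cases "x = 0 \<or> y = 0 \<or> tent B x = tent B y")
    case True
    then show ?thesis using reaches_by_event by simp
  next
    case False
    define k where "k = m * 2 ^ n"
    have k: "k > 0" "B = 5 * k" using m by (simp_all add: k_def B_def)
    obtain r s where rs: "x = r * k" "y = s * k" using base by (metis dvdE k_def mult.commute)
    have "r \<in> {1..4}" "s \<in> {1..4}" using False base k
      by (auto simp: rs zero_le_mult_iff mult_less_cancel_right)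
    moreover have "r \<noteq> s" "r + s \<noteq> 5"
      using False by (auto simp: rs tent_eq_iff k(2) simp flip: distrib_right)
    ultimately have "(\<bar>5 - 2 * r\<bar>, \<bar>5 - 2 * s\<bar>) \<in> {(1, 3), (3, 1)}" by (simp; presburger)
    moreover have "tent B (c * k) = \<bar>5 - 2 * c\<bar> * k" for c
    proof -
      have "B - 2 * (c * k) = (5 - 2 * c) * k" by (simp add: k(2) algebra_simps)
      then show ?thesis using k(1) unfolding tent_def by (simp add: abs_mult)
    qed
    ultimately have "step B (x, y) \<in> fixed_pair B"
      using False by (auto simp: rs step_def fixed_pair_def k(2))
    then show ?thesis by (intro reaches_imp_reaches_by) (simp add: reaches_def)
  qed
next
  case (step i)
  show ?case
  proof (cases "x = 0 \<or> y = 0 \<or> tent B x = tent B y")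
    case True
    then show ?thesis using reaches_by_event by simp
  next
    case False
    have "m * 2 ^ Suc i dvd B" using step.hyps le_imp_power_dvd[of "Suc i" n "2::int"]
      by (simp add: B_def mult.assoc mult_dvd_mono del: power_Suc)
    moreover have "m * 2 ^ Suc i dvd 2 * x" "m * 2 ^ Suc i dvd 2 * y"
      using step.prems(5,6) by (simp_all add: mult.left_commute)
    ultimately have "m * 2 ^ Suc i dvd tent B x" "m * 2 ^ Suc i dvd tent B y"
      unfolding tent_def dvd_abs_iff by (blast intro: dvd_diff)+
    then have "reaches_by B (n + 1 - Suc i) (tent B x, tent B y)"
      using step.IH False step.prems tent_bounds[of x B] tent_bounds[of y B] by simp
    moreover have "1 + (n + 1 - Suc i) \<le> n + 1 - i" using step.hyps by simp
    ultimately show ?thesis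
      using reaches_by_leads[OF B(1,2) leads_tent] False by blast
  qed
qed

lemma reaches_by_Suc_n:
  assumes "valid B s"
  shows "reaches_by B (n + 1) s"
proof (cases "m dvd fst s \<and> m dvd snd s")
  case True
  then show ?thesis using reaches_by_diff[of 0 "fst s" "snd s"] assms by (simp add: valid_def)
next
  case False
  then show ?thesis using not_reaches by (simp add: reaches_by_def)
qed

text \<open>The orbit of \<open>(2, 1)\<close> in base \<open>5 * 2 ^ n\<close>, scaled by
  \<open>m\<close>; the odd coordinate 1 makes \<open>n\<close> steps insufficient. The case
  \<open>n = 0\<close> lies outside that locale.\<close>

lemma first_reaches_Suc_n: "first_reaches B (n + 1) (m * 2, m * 1)"
proof (cases "n = 0")
  case True
  then show ?thesis using m
    by (simp add: first_reaches_def reaches_def fixed_pair_def step_def tent_def B_def)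
next
  case False
  then interpret b: base_5_pow_2 n "5 * 2 ^ n" by unfold_locales auto
  have o: "b.opposite_res (2, 1)" "b.opposite_res (1, 2)"
    by (simp_all add: b.opposite_res_def res1_def res2_def)
  have "(2::int) < 5 * 2 ^ n" using one_le_power[of "2::int" n] by linarith
  then have "reaches (5 * 2 ^ n) (n + 1) (2, 1)" "\<not> reaches (5 * 2 ^ n) n (2, 1)"
    using b.opposite_res_reaches[OF o(2)] b.opposite_res_not_reaches[OF o(2)]
    by (simp_all add: reaches_swap[of _ _ 2 1])
  moreover have "m * (5 * 2 ^ n) = B" by (simp add: B_def)
  ultimately show ?thesis
    using b.reaches_mult[OF o(1), of m] m unfolding first_reaches_def by simp
qed

end

lemma kaprekar_M_5_odd_pow2:
  assumes "odd m" "m > 1"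
  shows "kaprekar_M (5 * m * 2 ^ n) = n + 2"
proof -
  interpret base_5_odd_pow_2 n "int m" "int (5 * m * 2 ^ n)"
    using assms by unfold_locales auto
  have "kaprekar_M (5 * m * 2 ^ n) = n + 1 + 1"
  proof (rule kaprekar_M_eq_distance)
    show "reaches_by (int (5 * m * 2 ^ n)) (n + 1) s" if "valid (int (5 * m * 2 ^ n)) s" for s
      using that by (rule reaches_by_Suc_n)
    show "first_reaches (int (5 * m * 2 ^ n)) (n + 1) (int m * 2, int m * 1)"
      by (rule first_reaches_Suc_n)
    have "int m * 2 < int m * (5 * 2 ^ n)"
      using assms one_le_power[of "2::int" n] by (intro mult_strict_left_mono) linarith+
    then show "valid (int (5 * m * 2 ^ n)) (int m * 2, int m * 1)"
      using assms by (simp add: valid_def mult_ac)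
  qed (use assms in auto)
  then show ?thesis by simp
qed

lemma kaprekar_M_5_pow2:
  assumes "n \<ge> 3"
  shows "kaprekar_M (5 * 2 ^ n) = max_distance n + 1"
proof -
  interpret base_5_pow_2 n "int (5 * 2 ^ n)"
    using assms by unfold_locales auto
  obtain p q where "valid (int (5 * 2 ^ n)) (p, q)" "q \<le> p"
    "first_reaches (int (5 * 2 ^ n)) (max_distance n) (p, q)"
    using first_reaches_max_distance[OF assms] by blast
  then show ?thesis
    using kaprekar_M_eq_distance[of "5 * 2 ^ n" "max_distance n" p q] reaches_by_max_distance by simp
qed

theorem theorem1p1:
  shows "(kaprekar_M 2 = 1 \<and> kaprekar_M 4 = 3 \<and> kaprekar_M 5 = 4 \<and>
          kaprekar_M 10 = 7 \<and> kaprekar_M 20 = 10) \<and>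
         (\<forall>b m n :: nat. odd m \<and> m > 1 \<and> b = 5 * m * 2 ^ n \<longrightarrow> kaprekar_M b = n + 2) \<and>
         (\<forall>b n :: nat. b = 5 * 2 ^ n \<and> n \<ge> 3 \<longrightarrow>
            kaprekar_M b =
              (if n mod 4 = 0 then 4 * n + 6
               else if n mod 4 = 1 then 3 * n + 5
               else if n mod 4 = 2 then 3 * n + 5
               else 5 * n + 6))"
proof (intro conjI allI impI)
  show "kaprekar_M 2 = 1" by (rule kaprekar_M_2)
  show "kaprekar_M 4 = 3" by (rule kaprekar_M_4)
  show "kaprekar_M 5 = 4" by (rule kaprekar_M_5)
  show "kaprekar_M 10 = 7" by (rule kaprekar_M_10)
  show "kaprekar_M 20 = 10" by (rule kaprekar_M_20)
next
  fix b m n :: nat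
  assume "odd m \<and> m > 1 \<and> b = 5 * m * 2 ^ n"
  then show "kaprekar_M b = n + 2" using kaprekar_M_5_odd_pow2 by simp
next
  fix b n :: nat
  assume "b = 5 * 2 ^ n \<and> n \<ge> 3"
  then have "kaprekar_M b = max_distance n + 1" using kaprekar_M_5_pow2 by simp
  then show "kaprekar_M b =
      (if n mod 4 = 0 then 4 * n + 6
       else if n mod 4 = 1 then 3 * n + 5
       else if n mod 4 = 2 then 3 * n + 5
       else 5 * n + 6)"
    using mod_4_exhaust[of n] by (auto simp: max_distance_def)
qed

end
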